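(* The discrete Riesz transforms $$\mathcal{R}=\lim_{\alpha\to(1/2)^-}D(-\Delta_{\mathrm d})^{-\alpha}\qquad\text{and}\qquad\widetilde{\mathcal{R}}=\lim_{\alpha\to(1/2)^-}\widetilde D(-\Delta_{\mathrm d})^{-\alpha}$$ are operators acting on $\mathcal{S}(\mathbb{Z})$ by the convolution with the sequences $\left\{\frac{1}{\pi(n+1/2)}\right\}_{n\in\mathbb{Z}}$ and $\left\{\frac{1}{\pi(n-1/2)}\right\}_{n\in\mathbb{Z}}$, respectively.
   Context: $\mathcal{S}(\mathbb{Z})$ is the space of sequences $\{c_n\}_{n\in\mathbb{Z}}$ such that for each $k\in\mathbb{N}$ there exists $C_k$ with $\sup_{n\in\mathbb{Z}}|n|^k|c_n|<C_k$. Convolution on $\mathbb{Z}$ is $g*f(n)=\sum_{m\in\mathbb{Z}}g(n-m)f(m)$. The difference operators are $\Delta_{\mathrm d}f(n)=f(n+1)-2f(n)+f(n-1)$, $Df(n)=f(n+1)-f(n)$ and $\widetilde Df(n)=f(n)-f(n-1)$. For $k\in\mathbb{Z}$, $I_k(t)=\sum_{m=0}^\infty\frac{1}{m!\,\Gamma(m+k+1)}\left(\frac t2\right)^{2m+k}$ is the modified Bessel function of the first kind (with $1/\Gamma(j)$ taken to be $0$ for $j=0,-1,-2,\dots$), and $e^{t\Delta_{\mathrm d}}f(n)=\sum_{m\in\mathbb{Z}}e^{-2t}I_{n-m}(2t)f(m)$ is the discrete heat semigroup. For $0<\alpha<1/2$ the discrete fractional integral is $(-\Delta_{\mathrm d})^{-\alpha}=\frac{1}{\Gamma(\alpha)}\int_0^\infty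 e^{t\Delta_{\mathrm d}}\,t^{\alpha}\frac{dt}{t}$; with the Fourier transform $\mathcal{F}_{\mathbb{Z}}(f)(\theta)=\sum_{n}f(n)e^{in\theta}$, it is understood as the operator of multiplication by $\left(4\sin^2\frac\theta2\right)^{-\alpha}$ on the Fourier side. The limits defining $\mathcal{R}$ and $\widetilde{\mathcal{R}}$ are taken at the level of the corresponding Fourier multipliers.
   Formalization: The printed kernels have the wrong sign for Df(n)=f(n+1)-f(n): applied to the unit sequence at 0, R has value -2/π at n=0, not 2/π. The formal theorem proves convolution with -1/(π(n+1/2)) and -1/(π(n-1/2)) instead. *)

theory Defs
  imports "HOL-Analysis.Analysis"
begin

definition schwartz_Z :: "(int \<Rightarrow> complex) set" where
  "schwartz_Z = {c. \<forall>k::nat. \<exists>C::real. \<forall>n. \<bar>real_of_int n\<bar> ^ k * norm (c n) < C}"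

definition conv_Z :: "(int \<Rightarrow> complex) \<Rightarrow> (int \<Rightarrow> complex) \<Rightarrow> int \<Rightarrow> complex" where
  "conv_Z g f n = (\<Sum>\<^sub>\<infinity>m\<in>UNIV. g (n - m) * f m)"

definition fwd_diff :: "(int \<Rightarrow> complex) \<Rightarrow> int \<Rightarrow> complex" where
  "fwd_diff f n = f (n + 1) - f n"

definition bwd_diff :: "(int \<Rightarrow> complex) \<Rightarrow> int \<Rightarrow> complex" where
  "bwd_diff f n = f n - f (n - 1)"

text \<open>
  \<^const>\<open>rGamma\<close> is the entire function \<open>1 / \<Gamma>\<close>, so it vanishes at the non-positive
  integers. The only summands with a negative exponent are multiplied by such a zero.
\<close>
definition bessel_I :: "int \<Rightarrow> real \<Rightarrow> real" where
  "bessel_I k t =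
     (\<Sum>m. rGamma (real_of_int (int m + k + 1)) / fact m * (t / 2) powi (2 * int m + k))"

definition heat_semigroup :: "real \<Rightarrow> (int \<Rightarrow> complex) \<Rightarrow> int \<Rightarrow> complex" where
  "heat_semigroup t f n =
     (\<Sum>\<^sub>\<infinity>m\<in>UNIV. complex_of_real (exp (- 2 * t) * bessel_I (n - m) (2 * t)) * f m)"

text \<open>
  On \<^const>\<open>schwartz_Z\<close> the integral converges absolutely for \<open>0 < \<alpha> < 1 / 2\<close>, because the
  heat kernel is of order \<open>t powr (- 1 / 2)\<close> at infinity.
\<close>
definition frac_integral :: "real \<Rightarrow> (int \<Rightarrow> complex) \<Rightarrow> int \<Rightarrow> complex" where
  "frac_integral \<alpha> f n =
     1 / complex_of_real (Gamma \<alpha>) *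
     (LBINT t:{0<..}. heat_semigroup t f n * complex_of_real (t powr \<alpha>) / complex_of_real t)"

definition fourier_Z :: "(int \<Rightarrow> complex) \<Rightarrow> real \<Rightarrow> complex" where
  "fourier_Z f \<theta> = (\<Sum>\<^sub>\<infinity>n\<in>UNIV. f n * cis (of_int n * \<theta>))"

text \<open>
  \<open>T f\<close> need not be summable (the kernels below decay like \<open>1 / n\<close> in the limit), so
  \<open>\<F> (T f) = m \<cdot> \<F> f\<close> is read as: \<open>T f\<close> is the sequence of Fourier coefficients of
  \<open>m \<cdot> \<F> f\<close>. Integrability of \<open>m\<close> makes all the coefficient integrals meaningful and, with
  \<open>f\<close> the unit sequence at \<open>0\<close>, determines \<open>m\<close> up to a null set.
\<close>
definition has_fourier_multiplier ::
    "((int \<Rightarrow> complex) \<Rightarrow> int \<Rightarrow> complex) \<Rightarrow> (real \<Rightarrow> complex) \<Rightarrow> bool" where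
  "has_fourier_multiplier T m \<longleftrightarrow>
     set_integrable lborel {-pi..pi} m \<and>
     (\<forall>f\<in>schwartz_Z. \<forall>n. T f n =
        1 / (2 * complex_of_real pi) *
        (LBINT \<theta>:{-pi..pi}. m \<theta> * fourier_Z f \<theta> * cis (- (of_int n * \<theta>))))"

text \<open>
  The multipliers converge pointwise almost everywhere. The choice of representatives \<open>m \<alpha>\<close>
  is immaterial when the filter has a countable base, since then \<open>M\<close> is already determined,
  up to a null set, by a sequence of parameters.
\<close>
definition multiplier_limit ::
    "('p \<Rightarrow> (int \<Rightarrow> complex) \<Rightarrow> int \<Rightarrow> complex) \<Rightarrow> 'p filter \<Rightarrow>
     ((int \<Rightarrow> complex) \<Rightarrow> int \<Rightarrow> complex) \<Rightarrow> bool" where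
  "multiplier_limit T F R \<longleftrightarrow>
     (\<exists>m M. (\<forall>\<^sub>F \<alpha> in F. has_fourier_multiplier (T \<alpha>) (m \<alpha>)) \<and>
            (AE \<theta> in lborel. \<theta> \<in> {-pi..pi} \<longrightarrow> ((\<lambda>\<alpha>. m \<alpha> \<theta>) \<longlongrightarrow> M \<theta>) F) \<and>
            has_fourier_multiplier R M)"

text \<open>
  Sign convention. With \<open>\<F> f \<theta> = (\<Sum>n. f n * exp (\<i> n \<theta>))\<close> the operator
  \<^const>\<open>fwd_diff\<close> has multiplier \<open>exp (- \<i> \<theta>) - 1\<close>, and the limiting multiplier of the forward
  Riesz transform is \<open>- \<i> exp (- \<i> \<theta> / 2)\<close> on \<open>(0, 2 \<pi>)\<close>. Its Fourier coefficients are
  \<open>- 1 / (\<pi> (n + 1 / 2))\<close>, with a minus sign; similarly \<open>- 1 / (\<pi> (n - 1 / 2))\<close> for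
  \<^const>\<open>bwd_diff\<close>. The literature also prints these kernels without the minus sign, which is the
  transform built from \<open>- fwd_diff\<close> and \<open>- bwd_diff\<close>.
\<close>

end

theory Submission
  imports Defs
begin

text \<open>
  An operator with multiplier \<open>m\<close> is convolution with the sequence of Fourier coefficients of \<open>m\<close>
  (\<open>has_fourier_multiplier_iff\<close>): for a summable \<open>f\<close> the sum defining \<open>\<F> f\<close> may be
  exchanged with the coefficient integral. The claim about \<open>\<R>\<close> then splits into three parts.

  First, the multiplier of \<open>(-\<Delta>) powr - \<alpha>\<close>. The generating function
  \<open>exp (x cos \<theta>) = exp ((x / 2) exp (\<i>\<theta>)) exp ((x / 2) exp (-\<i>\<theta>))\<close> is a product of two absolutely
  convergent Fourier series, whose coefficients convolve to \<open>I_n(x)\<close>; so the heat kernel at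
  time \<open>t\<close> has the multiplier \<open>exp (-4 t sin\<^sup>2 (\<theta> / 2))\<close> (\<open>fourier_coeff_heat_kernel\<close>). Integrating
  in \<open>t\<close> against \<open>t powr (\<alpha> - 1) / \<Gamma>(\<alpha>)\<close> gives Euler's integral, and the result
  \<open>(4 sin\<^sup>2 (\<theta> / 2)) powr - \<alpha>\<close> has at \<open>0\<close> a singularity of order \<open>\<bar>\<theta>\<bar> powr (- 2\<alpha>)\<close>, which is
  integrable for \<open>\<alpha> < 1 / 2\<close>; this justifies Fubini's theorem (\<open>frac_integral_eq\<close>).

  Second, the limit. The factor \<open>exp (-\<i>\<theta>) - 1\<close> of the forward difference vanishes at \<open>0\<close> to
  first order, so the multipliers \<open>riesz_symbol \<alpha>\<close> converge to the bounded function
  \<open>- \<i> sgn \<theta> exp (-\<i>\<theta> / 2)\<close>, whose coefficients are elementary integrals (\<open>riesz_kernel\<close>).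

  Third, the limit operator is unique. An integrable function all of whose Fourier
  coefficients vanish is zero almost everywhere (\<open>null_spectrum_imp_AE_zero\<close>), so the multipliers
  of the approximating operators, and along a sequence of parameters also their limit, are
  determined up to null sets (\<open>multiplier_limit_iff\<close>).

  The backward difference is the forward difference shifted by one, which multiplies the
  multipliers by \<open>exp (\<i>\<theta>)\<close> and shifts the kernel.
\<close>

section \<open>Fourier coefficients and convolution\<close>

abbreviation torus :: "real measure" where
  "torus \<equiv> restrict_space lborel {-pi..pi}"

abbreviation summable_Z :: "(int \<Rightarrow> complex) \<Rightarrow> bool" where
  "summable_Z f \<equiv> Infinite_Set_Sum.abs_summable_on f UNIV"

definition fourier_coeff :: "(real \<Rightarrow> complex) \<Rightarrow> int \<Rightarrow> complex" where
  "fourier_coeff m n = 1 / (2 * complex_of_real pi) * (\<integral>\<theta>. m \<theta> * cis (- (of_int n * \<theta>)) \<partial>torus)"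

interpretation torus: finite_measure torus
  by (rule finite_measureI) (simp add: emeasure_restrict_space space_restrict_space)

lemma measure_torus: "measure torus {-pi..pi} = 2 * pi"
  by (simp add: measure_restrict_space space_restrict_space)

lemma measurable_cis [measurable]: "cis \<in> borel_measurable borel"
  by (intro borel_measurable_continuous_onI continuous_intros)

lemma measurable_torus: "f \<in> borel_measurable borel \<Longrightarrow> f \<in> borel_measurable torus"
  by (intro measurable_restrict_space1) simp

lemma integrable_torus_mult_bounded:
  fixes f g :: "real \<Rightarrow> complex"
  assumes "integrable torus f" "g \<in> borel_measurable torus" "\<And>\<theta>. norm (g \<theta>) \<le> B"
  shows "integrable torus (\<lambda>\<theta>. f \<theta> * g \<theta>)"
proof (rule Bochner_Integration.integrable_bound)
  show "integrable torus (\<lambda>\<theta>. B *\<^sub>R f \<theta>)"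
    using assms by simp
  show "(\<lambda>\<theta>. f \<theta> * g \<theta>) \<in> borel_measurable torus"
    using assms by measurable
  have "norm (f x) * norm (g x) \<le> norm (f x) * \<bar>B\<bar>" for x
    using assms(3)[of x] by (intro mult_left_mono) auto
  then show "AE \<theta> in torus. norm (f \<theta> * g \<theta>) \<le> norm (B *\<^sub>R f \<theta>)"
    by (intro AE_I2) (simp add: norm_mult mult.commute)
qed

lemma measurable_cis_affine: "(\<lambda>\<theta>. cis (c * \<theta>)) \<in> borel_measurable torus"
  by (rule measurable_torus) measurable

lemma integrable_torus_mult_cis:
  assumes "integrable torus f"
  shows "integrable torus (\<lambda>\<theta>. f \<theta> * cis (c * \<theta>))"
  using assms measurable_cis_affine by (rule integrable_torus_mult_bounded[where B=1]) simp

lemma summable_Z_mult_bounded: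
  assumes "summable_Z f" "\<And>n. norm (g n) \<le> B"
  shows "summable_Z (\<lambda>n. g n * f n)"
proof (rule Infinite_Set_Sum.abs_summable_on_comparison_test)
  show "summable_Z (\<lambda>n. complex_of_real B * f n)"
    using assms(1) by (rule Infinite_Set_Sum.abs_summable_on_cmult_right)
  show "norm (g n * f n) \<le> norm (complex_of_real B * f n)" for n
    using order_trans[OF assms(2)[of n] abs_ge_self] by (simp add: norm_mult mult_right_mono)
qed

lemma fourier_Z_integral:
  assumes "summable_Z f"
  shows "fourier_Z f \<theta> = (\<integral>n. f n * cis (of_int n * \<theta>) \<partial>count_space UNIV)"
proof -
  have "summable_Z (\<lambda>n. cis (of_int n * \<theta>) * f n)"
    using assms by (rule summable_Z_mult_bounded[where B=1]) simp
  then show ?thesis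
    by (simp add: fourier_Z_def mult.commute infsetsum_infsum[symmetric] infsetsum_def)
qed

lemma measurable_fourier_Z:
  assumes "summable_Z f"
  shows "fourier_Z f \<in> borel_measurable torus"
proof (rule measurable_torus)
  interpret sigma_finite_measure "count_space (UNIV :: int set)"
    by (rule sigma_finite_measure_count_space)
  have "(\<lambda>\<theta>. \<integral>n. f n * cis (of_int n * \<theta>) \<partial>count_space UNIV) \<in> borel_measurable borel"
    by (rule borel_measurable_lebesgue_integral)
      (auto simp: case_prod_beta intro!: borel_measurable_times measurable_compose[OF _ measurable_cis])
  then show "fourier_Z f \<in> borel_measurable borel"
    using assms by (simp add: fourier_Z_integral cong: measurable_cong)
qed

lemma norm_fourier_Z_le:
  assumes "summable_Z f"
  shows "norm (fourier_Z f \<theta>) \<le> (\<integral>n. norm (f n) \<partial>count_space UNIV)"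
proof -
  have "norm (fourier_Z f \<theta>) \<le> (\<integral>n. norm (f n * cis (of_int n * \<theta>)) \<partial>count_space UNIV)"
    unfolding fourier_Z_integral[OF assms] by (rule integral_norm_bound)
  then show ?thesis by (simp add: norm_mult)
qed

lemma integrable_torus_mult_fourier_Z:
  assumes "integrable torus m" "summable_Z f"
  shows "integrable torus (\<lambda>\<theta>. m \<theta> * fourier_Z f \<theta>)"
  using assms(1) measurable_fourier_Z[OF assms(2)] norm_fourier_Z_le[OF assms(2)]
  by (rule integrable_torus_mult_bounded)

lemma norm_fourier_coeff_le:
  "norm (fourier_coeff m n) \<le> 1 / (2 * pi) * (\<integral>\<theta>. norm (m \<theta>) \<partial>torus)"
proof -
  have "norm (\<integral>\<theta>. m \<theta> * cis (- (of_int n * \<theta>)) \<partial>torus) \<le> (\<integral>\<theta>. norm (m \<theta> * cis (- (of_int n * \<theta>))) \<partial>torus)"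
    by (rule integral_norm_bound)
  then show ?thesis
    by (simp add: fourier_coeff_def norm_mult norm_divide divide_right_mono)
qed

text \<open>
  Expanding \<open>\<F> f\<close> and integrating term by term turns the factor \<open>f j exp (\<i>j\<theta>)\<close> into \<open>f j\<close> times
  the coefficient of index \<open>n - j\<close>. The sum is an integral over the counting measure, so the
  exchange is Fubini's theorem; integrability of \<open>m\<close> and summability of \<open>f\<close> are exactly the
  domination that it needs.
\<close>
theorem fourier_coeff_mult_fourier_Z:
  assumes m: "integrable torus m" and f: "summable_Z f"
  shows "fourier_coeff (\<lambda>\<theta>. m \<theta> * fourier_Z f \<theta>) = conv_Z (fourier_coeff m) f"
proof
  fix n :: int
  define K where "K = (\<lambda>(j, \<theta>). m \<theta> * (f j * cis (of_int j * \<theta>)) * cis (- (of_int n * \<theta>)))"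
  interpret S: sigma_finite_measure "count_space (UNIV :: int set)"
    by (rule sigma_finite_measure_count_space)
  interpret P: pair_sigma_finite "count_space (UNIV :: int set)" torus ..
  have cis_shift: "cis (of_int j * \<theta>) * cis (- (of_int n * \<theta>)) = cis (- (of_int (n - j) * \<theta>))" for j \<theta>
    by (simp add: cis_mult algebra_simps)
  have K_eq: "K (j, \<theta>) = f j * (m \<theta> * cis (- (of_int (n - j) * \<theta>)))" for j \<theta>
    unfolding K_def cis_shift[symmetric] by simp
  have int_j: "integrable torus (\<lambda>\<theta>. m \<theta> * cis (- (of_int j * \<theta>)))" for j :: int
    using integrable_torus_mult_cis[OF m, of "- of_int j"] by simp
  have "integrable (count_space UNIV \<Otimes>\<^sub>M torus) K"
  proof (rule P.Fubini_integrable)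
    have "(\<lambda>\<theta>. K (j, \<theta>)) \<in> borel_measurable torus" for j
      unfolding K_eq by (rule borel_measurable_times[OF borel_measurable_const borel_measurable_integrable[OF int_j]])
    then show "K \<in> borel_measurable (count_space UNIV \<Otimes>\<^sub>M torus)"
      by (intro measurable_pair_measure_countable1) auto
    have "(\<integral>\<theta>. norm (K (j, \<theta>)) \<partial>torus) = norm (f j) * (\<integral>\<theta>. norm (m \<theta>) \<partial>torus)" for j
      unfolding K_eq by (simp add: norm_mult)
    then show "integrable (count_space UNIV) (\<lambda>j. \<integral>\<theta>. norm (K (j, \<theta>)) \<partial>torus)"
      using f by (simp add: abs_summable_on_def)
    show "AE j in count_space UNIV. integrable torus (\<lambda>\<theta>. K (j, \<theta>))"
      unfolding K_eq by (intro AE_I2 integrable_mult_right int_j)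
  qed
  then have "(\<integral>\<theta>. (\<integral>j. K (j, \<theta>) \<partial>count_space UNIV) \<partial>torus) = (\<integral>j. (\<integral>\<theta>. K (j, \<theta>) \<partial>torus) \<partial>count_space UNIV)"
    by (intro P.Fubini_integral) simp
  moreover have "(\<integral>j. K (j, \<theta>) \<partial>count_space UNIV) = m \<theta> * fourier_Z f \<theta> * cis (- (of_int n * \<theta>))" for \<theta>
    by (simp add: K_def fourier_Z_integral[OF f])
  moreover have "(\<integral>\<theta>. K (j, \<theta>) \<partial>torus) = 2 * complex_of_real pi * (fourier_coeff m (n - j) * f j)" for j
    unfolding K_eq by (simp add: fourier_coeff_def)
  ultimately have "fourier_coeff (\<lambda>\<theta>. m \<theta> * fourier_Z f \<theta>) n = (\<integral>j. fourier_coeff m (n - j) * f j \<partial>count_space UNIV)"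
    by (simp add: fourier_coeff_def)
  moreover have "summable_Z (\<lambda>j. fourier_coeff m (n - j) * f j)"
    using f norm_fourier_coeff_le by (rule summable_Z_mult_bounded)
  ultimately show "fourier_coeff (\<lambda>\<theta>. m \<theta> * fourier_Z f \<theta>) n = conv_Z (fourier_coeff m) f n"
    by (simp add: conv_Z_def infsetsum_infsum[symmetric] infsetsum_def)
qed

lemma schwartz_Z_abs_summable:
  assumes "f \<in> schwartz_Z"
  shows "summable_Z f"
proof -
  obtain C0 where C0: "\<And>n. norm (f n) < C0"
    using assms[unfolded schwartz_Z_def, simplified, rule_format, of 0] by auto
  obtain C2 where C2: "\<And>n. \<bar>real_of_int n\<bar> ^ 2 * norm (f n) < C2"
    using assms[unfolded schwartz_Z_def, simplified, rule_format, of 2] by auto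
  \<comment> \<open>Decay of order \<open>2\<close> suffices; the bound of order \<open>0\<close> covers \<open>n = 0\<close>.\<close>
  have bound: "norm (f n) \<le> (C0 + C2) * inverse (1 + \<bar>real_of_int n\<bar> ^ 2)" for n
  proof -
    have "0 < 1 + \<bar>real_of_int n\<bar> ^ 2" by (simp add: add_pos_nonneg)
    then show ?thesis
      using C0[of n] C2[of n] by (simp add: pos_le_divide_eq divide_inverse[symmetric] algebra_simps)
  qed
  have *: "Infinite_Set_Sum.abs_summable_on (\<lambda>k::nat. (C0 + C2) * inverse (1 + real k ^ 2)) UNIV"
  proof (intro Infinite_Set_Sum.abs_summable_on_cmult_right)
    have "summable (\<lambda>k. 1 / real k ^ 2)"
      using inverse_power_summable[of 2, where 'a=real] by (simp add: inverse_eq_divide)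
    then have "summable (\<lambda>k. norm (inverse (1 + real k ^ 2)))"
    proof (rule summable_comparison_test'[where N=1])
      show "norm (norm (inverse (1 + real k ^ 2))) \<le> 1 / real k ^ 2" if "1 \<le> k" for k
        using that frac_le[of 1 1 "real k ^ 2" "1 + real k ^ 2"] by (simp add: inverse_eq_divide)
    qed
    then show "Infinite_Set_Sum.abs_summable_on (\<lambda>k. inverse (1 + real k ^ 2)) UNIV"
      by (simp add: abs_summable_on_nat_iff')
  qed
  have "Infinite_Set_Sum.abs_summable_on f (range int)"
  proof -
    have "Infinite_Set_Sum.abs_summable_on (\<lambda>k. f (int k)) UNIV"
      using * by (rule Infinite_Set_Sum.abs_summable_on_comparison_test) (use order_trans[OF bound abs_ge_self, of "int _"] in force)
    then show ?thesis
      by (simp add: Infinite_Set_Sum.abs_summable_on_reindex_iff[of int UNIV f, symmetric])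
  qed
  moreover have "Infinite_Set_Sum.abs_summable_on f (range (\<lambda>k. - int k))"
  proof -
    have "Infinite_Set_Sum.abs_summable_on (\<lambda>k. f (- int k)) UNIV"
      using * by (rule Infinite_Set_Sum.abs_summable_on_comparison_test) (use order_trans[OF bound abs_ge_self, of "- int _"] in force)
    then show ?thesis
      by (subst (asm) Infinite_Set_Sum.abs_summable_on_reindex_iff) (auto simp: inj_on_def)
  qed
  moreover have "(UNIV :: int set) = range int \<union> range (\<lambda>k. - int k)"
  proof -
    have "n \<in> range int \<union> range (\<lambda>k. - int k)" for n
      by (cases n rule: int_cases2) auto
    then show ?thesis by blast
  qed
  ultimately show ?thesis
    by (metis Infinite_Set_Sum.abs_summable_on_union)
qed

text \<open>
  This replaces the coefficient integrals of the definition by a kernel that does not depend on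
  \<open>f\<close>; all later arguments use multipliers in this form.
\<close>
theorem has_fourier_multiplier_iff:
  "has_fourier_multiplier T m \<longleftrightarrow>
     integrable torus m \<and> (\<forall>f\<in>schwartz_Z. T f = conv_Z (fourier_coeff m) f)"
proof -
  have set_int: "set_integrable lborel {-pi..pi} m \<longleftrightarrow> integrable torus m"
    by (simp add: set_integrable_def integrable_restrict_space)
  have "1 / (2 * complex_of_real pi) * (LBINT \<theta>:{-pi..pi}. m \<theta> * fourier_Z f \<theta> * cis (- (of_int n * \<theta>)))
      = conv_Z (fourier_coeff m) f n" if "integrable torus m" "f \<in> schwartz_Z" for f n
    unfolding fourier_coeff_mult_fourier_Z[OF that(1) schwartz_Z_abs_summable[OF that(2)], symmetric]
    by (simp add: fourier_coeff_def set_lebesgue_integral_def integral_restrict_space)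
  then show ?thesis
    unfolding has_fourier_multiplier_def set_int by (auto simp: fun_eq_iff)
qed

lemma integrable_torus_mult_cis_minus:
  "integrable torus h \<Longrightarrow> integrable torus (\<lambda>\<theta>. h \<theta> * cis (- (of_int n * \<theta>)))"
  using integrable_torus_mult_cis[of h "- of_int n"] by simp

lemma fourier_coeff_add:
  assumes "integrable torus g" "integrable torus h"
  shows "fourier_coeff (\<lambda>\<theta>. g \<theta> + h \<theta>) n = fourier_coeff g n + fourier_coeff h n"
  using assms[THEN integrable_torus_mult_cis_minus, of n]
  by (simp add: fourier_coeff_def distrib_right distrib_left)

lemma fourier_coeff_diff:
  assumes "integrable torus g" "integrable torus h"
  shows "fourier_coeff (\<lambda>\<theta>. g \<theta> - h \<theta>) n = fourier_coeff g n - fourier_coeff h n"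
  using assms[THEN integrable_torus_mult_cis_minus, of n]
  by (simp add: fourier_coeff_def left_diff_distrib right_diff_distrib)

lemma fourier_coeff_cmult: "fourier_coeff (\<lambda>\<theta>. c * h \<theta>) n = c * fourier_coeff h n"
  by (simp add: fourier_coeff_def mult.assoc)

lemma fourier_coeff_mult_cis:
  "fourier_coeff (\<lambda>\<theta>. h \<theta> * cis (of_int k * \<theta>)) n = fourier_coeff h (n - k)"
proof -
  have "cis (of_int k * \<theta>) * cis (- (of_int n * \<theta>)) = cis (- (of_int (n - k) * \<theta>))" for \<theta>
    by (simp add: cis_mult algebra_simps)
  then show ?thesis by (simp add: fourier_coeff_def mult.assoc)
qed

section \<open>Uniqueness of integrable multipliers\<close>

definition null_spectrum :: "(real \<Rightarrow> complex) \<Rightarrow> bool" where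
  "null_spectrum h \<longleftrightarrow> integrable torus h \<and> (\<forall>n. fourier_coeff h n = 0)"

lemma null_spectrum_add:
  "null_spectrum g \<Longrightarrow> null_spectrum h \<Longrightarrow> null_spectrum (\<lambda>\<theta>. g \<theta> + h \<theta>)"
  by (simp add: null_spectrum_def fourier_coeff_add)

lemma null_spectrum_cmult: "null_spectrum h \<Longrightarrow> null_spectrum (\<lambda>\<theta>. c * h \<theta>)"
  by (simp add: null_spectrum_def fourier_coeff_cmult)

lemma null_spectrum_mult_cis: "null_spectrum h \<Longrightarrow> null_spectrum (\<lambda>\<theta>. h \<theta> * cis (of_int k * \<theta>))"
  by (simp add: null_spectrum_def fourier_coeff_mult_cis integrable_torus_mult_cis)

text \<open>
  Formulated as an operation on \<open>h\<close>, the statement is closed under products of polynomials for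
  free, so trigonometric polynomials need not be multiplied out. A real-linear function on the
  circle is a combination of \<open>exp (\<i>\<theta>)\<close> and \<open>exp (-\<i>\<theta>)\<close>, which only shift the coefficients.
\<close>
lemma null_spectrum_mult_polynomial:
  fixes p :: "complex \<Rightarrow> real"
  assumes "real_polynomial_function p" "null_spectrum h"
  shows "null_spectrum (\<lambda>\<theta>. h \<theta> * of_real (p (cis \<theta>)))"
  using assms
proof (induction arbitrary: h)
  case (linear p)
  interpret bounded_linear p by fact
  have p_cis: "complex_of_real (p (cis \<theta>)) = (of_real (p 1) - \<i> * of_real (p \<i>)) / 2 * cis \<theta>
      + (of_real (p 1) + \<i> * of_real (p \<i>)) / 2 * cis (- \<theta>)" for \<theta>
  proof -
    have "cis \<theta> = cos \<theta> *\<^sub>R 1 + sin \<theta> *\<^sub>R \<i>" by (simp add: complex_eq_iff)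
    then have "p (cis \<theta>) = cos \<theta> * p 1 + sin \<theta> * p \<i>" by (simp only: add scaleR real_scaleR_def)
    then show ?thesis by (simp add: complex_eq_iff field_simps)
  qed
  have "null_spectrum (\<lambda>\<theta>. (of_real (p 1) - \<i> * of_real (p \<i>)) / 2 * (h \<theta> * cis (of_int 1 * \<theta>))
      + (of_real (p 1) + \<i> * of_real (p \<i>)) / 2 * (h \<theta> * cis (of_int (- 1) * \<theta>)))"
    using linear.prems by (intro null_spectrum_add null_spectrum_cmult null_spectrum_mult_cis)
  then show ?case
    by (simp add: p_cis distrib_left mult_ac)
next
  case (const c)
  then show ?case using null_spectrum_cmult[of h "of_real c"] by (simp add: mult.commute)
next
  case (add p q)
  then show ?case using null_spectrum_add by (simp add: distrib_left)
next
  case (mult p q)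
  then show ?case by (simp add: mult.assoc[symmetric])
qed

text \<open>
  Continuous functions on the circle are uniform limits of polynomials in the two coordinates
  (Stone--Weierstrass), and integration against the integrable \<open>h\<close> respects uniform limits.
\<close>
lemma null_spectrum_orthogonal_continuous:
  fixes \<phi> :: "complex \<Rightarrow> real"
  assumes h: "null_spectrum h" and \<phi>: "continuous_on UNIV \<phi>"
  shows "(\<integral>\<theta>. h \<theta> * of_real (\<phi> (cis \<theta>)) \<partial>torus) = 0"
proof -
  define I where "I = (\<integral>\<theta>. norm (h \<theta>) \<partial>torus)"
  have int_h: "integrable torus h" using h by (simp add: null_spectrum_def)
  have cont_circle: "\<phi>' \<circ> cis \<in> borel_measurable torus" if "continuous_on UNIV \<phi>'" for \<phi>' :: "complex \<Rightarrow> real"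
    using that by (intro measurable_torus borel_measurable_continuous_onI continuous_on_compose)
      (auto intro!: continuous_intros elim: continuous_on_subset)
  have bound: "norm (\<integral>\<theta>. h \<theta> * of_real (\<phi> (cis \<theta>)) \<partial>torus) \<le> \<epsilon> * I" if "\<epsilon> > 0" for \<epsilon>
  proof -
    obtain p where p: "real_polynomial_function p" "\<And>z. z \<in> sphere 0 1 \<Longrightarrow> \<bar>\<phi> z - p z\<bar> < \<epsilon>"
      using Stone_Weierstrass_real_polynomial_function[OF compact_sphere _ \<open>\<epsilon> > 0\<close>, of 0 1 \<phi>] \<phi>
      by (metis continuous_on_subset top_greatest)
    have hp: "integrable torus (\<lambda>\<theta>. h \<theta> * of_real (p (cis \<theta>)))"
      and "fourier_coeff (\<lambda>\<theta>. h \<theta> * of_real (p (cis \<theta>))) 0 = 0"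
      using null_spectrum_mult_polynomial[OF p(1) h] by (auto simp: null_spectrum_def)
    then have hp0: "(\<integral>\<theta>. h \<theta> * of_real (p (cis \<theta>)) \<partial>torus) = 0"
      by (simp add: fourier_coeff_def)
    have meas: "(\<lambda>\<theta>. complex_of_real (\<phi> (cis \<theta>) - p (cis \<theta>))) \<in> borel_measurable torus"
    proof -
      have "continuous_on UNIV p"
        using p(1) by (intro continuous_at_imp_continuous_on ballI continuous_real_polymonial_function)
      from cont_circle[OF \<phi>] cont_circle[OF this]
      have "(\<lambda>\<theta>. \<phi> (cis \<theta>) - p (cis \<theta>)) \<in> borel_measurable torus"
        unfolding o_def by (rule borel_measurable_diff)
      then show ?thesis by measurable
    qed
    have err: "norm (complex_of_real (\<phi> (cis \<theta>) - p (cis \<theta>))) \<le> \<epsilon>" for \<theta>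
      using p(2)[of "cis \<theta>"] by (simp add: norm_of_real del: of_real_diff)
    have hd: "integrable torus (\<lambda>\<theta>. h \<theta> * of_real (\<phi> (cis \<theta>) - p (cis \<theta>)))"
      using int_h meas err by (rule integrable_torus_mult_bounded)
    have "(\<integral>\<theta>. h \<theta> * of_real (\<phi> (cis \<theta>)) \<partial>torus)
        = (\<integral>\<theta>. h \<theta> * of_real (\<phi> (cis \<theta>) - p (cis \<theta>)) + h \<theta> * of_real (p (cis \<theta>)) \<partial>torus)"
      by (simp add: algebra_simps)
    also have "\<dots> = (\<integral>\<theta>. h \<theta> * of_real (\<phi> (cis \<theta>) - p (cis \<theta>)) \<partial>torus)"
      using hp hd hp0 by (simp del: of_real_diff)
    also have "norm \<dots> \<le> (\<integral>\<theta>. \<epsilon> * norm (h \<theta>) \<partial>torus)"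
    proof (rule Bochner_Integration.integral_norm_bound_integral[OF hd])
      show "integrable torus (\<lambda>\<theta>. \<epsilon> * norm (h \<theta>))" using int_h by simp
      show "norm (h \<theta> * of_real (\<phi> (cis \<theta>) - p (cis \<theta>))) \<le> \<epsilon> * norm (h \<theta>)" for \<theta>
        unfolding norm_mult using err[of \<theta>] by (subst mult.commute) (rule mult_right_mono, auto)
    qed
    finally show ?thesis by (simp add: I_def)
  qed
  have "norm (\<integral>\<theta>. h \<theta> * of_real (\<phi> (cis \<theta>)) \<partial>torus) \<le> 0"
  proof (rule field_le_epsilon)
    fix e :: real assume "e > 0"
    have "I \<ge> 0" by (simp add: I_def)
    then have "e / (1 + I) * I \<le> e" using \<open>e > 0\<close> by (simp add: field_simps)
    then show "norm (\<integral>\<theta>. h \<theta> * of_real (\<phi> (cis \<theta>)) \<partial>torus) \<le> 0 + e"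
      using bound[of "e / (1 + I)"] \<open>e > 0\<close> \<open>I \<ge> 0\<close> by simp
  qed
  then show ?thesis by simp
qed

lemma AE_torus_interior: "AE \<theta> in torus. \<theta> \<in> {-pi<..<pi}"
proof -
  have "AE \<theta> in lborel. \<theta> \<in> {-pi..pi} \<longrightarrow> \<theta> \<in> {-pi<..<pi}"
    using AE_lborel_singleton[of "- pi"] AE_lborel_singleton[of pi] by eventually_elim auto
  then show ?thesis
    by (subst AE_restrict_space_iff) (auto simp only: sets_lborel space_lborel Int_UNIV_right borel_closed closed_atLeastAtMost)
qed

lemma cis_inj_on_interior:
  assumes "\<theta> \<in> {-pi<..<pi}" "\<eta> \<in> {-pi..pi}" "cis \<theta> = cis \<eta>"
  shows "\<theta> = \<eta>"
proof (cases "\<eta> = - pi")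
  case True
  have "Re (cis \<theta>) = Re (cis (- pi))" using assms(3) unfolding True by (rule arg_cong)
  then have "cos \<bar>\<theta>\<bar> = cos pi" by (simp only: cis.sel cos_minus cos_abs_real)
  with cos_inj_pi[of "\<bar>\<theta>\<bar>" pi] have "\<bar>\<theta>\<bar> = pi" using assms(1) by auto
  then show ?thesis using assms(1) by auto
next
  case False
  have "Arg (cis \<eta>) = \<theta>"
    using assms(1) by (intro cis_Arg_unique) (auto simp only: sgn_cis assms(3)[symmetric] greaterThanLessThan_iff less_imp_le)
  moreover have "Arg (cis \<eta>) = \<eta>"
    using assms(2) False by (intro cis_Arg_unique) (auto simp only: sgn_cis atLeastAtMost_iff less_le)
  ultimately show ?thesis by (simp only:)
qed

text \<open>
  The indicator of a closed set is a decreasing limit of continuous functions of the distance to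
  that set. Only functions of \<open>cis \<theta>\<close> are available, so the set is moved to the circle; the point
  where \<open>cis\<close> fails to be injective on \<open>{-pi..pi}\<close> is a null set.
\<close>
lemma null_spectrum_integral_closed:
  assumes h: "null_spectrum h" and C: "closed C"
  shows "(\<integral>\<theta>. h \<theta> * indicator C \<theta> \<partial>torus) = 0"
proof (cases "C \<inter> {-pi..pi} = {}")
  case True
  have "(\<integral>\<theta>. h \<theta> * indicator C \<theta> \<partial>torus) = (\<integral>\<theta>. 0 \<partial>torus)"
    using True by (intro Bochner_Integration.integral_cong) (auto simp: space_restrict_space indicator_def)
  then show ?thesis by simp
next
  case False
  define D where "D = cis ` (C \<inter> {-pi..pi})"
  \<comment> \<open>\<open>D\<close> is nonempty, as \<open>infdist\<close> to the empty set is \<open>0\<close>.\<close>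
  define \<phi> where "\<phi> k z = max 0 (1 - real k * infdist z D)" for k z
  have "compact D" unfolding D_def using C
    by (intro compact_continuous_image continuous_intros closed_Int_compact) auto
  have "D \<noteq> {}" using False by (simp add: D_def)
  have \<phi>_cont: "continuous_on UNIV (\<phi> k)" for k
    unfolding \<phi>_def by (intro continuous_intros)
  have \<phi>_lim: "(\<lambda>k. \<phi> k z) \<longlonglongrightarrow> indicator D z" for z
  proof (cases "z \<in> D")
    case True
    then show ?thesis by (simp add: \<phi>_def)
  next
    case False
    then have pos: "infdist z D > 0"
      using \<open>compact D\<close> \<open>D \<noteq> {}\<close> by (simp add: infdist_pos_not_in_closed compact_imp_closed)
    have "\<forall>\<^sub>F k in sequentially. \<phi> k z = 0"
      using eventually_ge_at_top[of "nat \<lceil>1 / infdist z D\<rceil>"]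
    proof eventually_elim
      case (elim k)
      then have "1 / infdist z D \<le> real k" by linarith
      then show ?case using pos by (simp add: \<phi>_def field_simps)
    qed
    then show ?thesis using False by (simp add: tendsto_eventually)
  qed
  have \<phi>_bounds: "0 \<le> \<phi> k z" "\<phi> k z \<le> 1" for k z
    by (auto simp: \<phi>_def infdist_nonneg)
  have int_h: "integrable torus h" using h by (simp add: null_spectrum_def)
  have cis_C: "AE \<theta> in torus. indicator D (cis \<theta>) = (indicator C \<theta> :: real)"
    using AE_torus_interior
  proof eventually_elim
    case (elim \<theta>)
    then show ?case
      using cis_inj_on_interior[of \<theta>] by (auto simp: D_def indicator_def image_iff)
  qed
  have "(\<lambda>k. \<integral>\<theta>. h \<theta> * of_real (\<phi> k (cis \<theta>)) \<partial>torus) \<longlonglongrightarrow> (\<integral>\<theta>. h \<theta> * indicator C \<theta> \<partial>torus)"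
  proof (rule integral_dominated_convergence[where w="\<lambda>\<theta>. norm (h \<theta>)"])
    show "integrable torus (\<lambda>\<theta>. norm (h \<theta>))" using int_h by simp
    show "(\<lambda>\<theta>. h \<theta> * indicator C \<theta>) \<in> borel_measurable torus"
      by (rule borel_measurable_times[OF borel_measurable_integrable[OF int_h] measurable_torus])
        (use C in simp)
    show "(\<lambda>\<theta>. h \<theta> * of_real (\<phi> k (cis \<theta>))) \<in> borel_measurable torus" for k
      by (rule borel_measurable_times[OF borel_measurable_integrable[OF int_h] measurable_torus])
        (intro borel_measurable_continuous_onI continuous_on_of_real
          continuous_on_compose2[OF \<phi>_cont, of UNIV cis] continuous_intros, simp)
    show "AE \<theta> in torus. norm (h \<theta> * of_real (\<phi> k (cis \<theta>))) \<le> norm (h \<theta>)" for k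
      using \<phi>_bounds by (auto simp: norm_mult mult_left_le)
    show "AE \<theta> in torus. (\<lambda>k. h \<theta> * of_real (\<phi> k (cis \<theta>))) \<longlonglongrightarrow> h \<theta> * indicator C \<theta>"
      using cis_C
    proof eventually_elim
      case (elim \<theta>)
      then have "(\<lambda>k. h \<theta> * of_real (\<phi> k (cis \<theta>))) \<longlonglongrightarrow> h \<theta> * of_real (indicator C \<theta>)"
        using \<phi>_lim[of "cis \<theta>"] by (intro tendsto_intros) simp
      then show ?case by (cases "\<theta> \<in> C") simp_all
    qed
  qed
  then show ?thesis
    unfolding null_spectrum_orthogonal_continuous[OF h \<phi>_cont] by (simp add: LIMSEQ_const_iff)
qed

text \<open>
  The closed sets form an intersection-stable generator of the Borel sets, so the integral of \<open>h\<close>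
  vanishes over every Borel set.
\<close>
theorem null_spectrum_imp_AE_zero:
  assumes h: "null_spectrum h"
  shows "AE \<theta> in torus. h \<theta> = 0"
proof -
  have int_h: "integrable torus h" using h by (simp add: null_spectrum_def)
  define g where "g \<theta> = indicator {-pi..pi} \<theta> *\<^sub>R h \<theta>" for \<theta>
  have int_g: "integrable lborel g"
    using int_h unfolding g_def by (simp add: integrable_restrict_space)
  have set_int: "set_integrable lborel A g" if "A \<in> sets borel" for A
    unfolding set_integrable_def using int_g that by (intro integrable_mult_indicator) auto
  have closed: "(LBINT \<theta>:C. g \<theta>) = 0" if "closed C" for C
  proof -
    have "(LBINT \<theta>:C. g \<theta>) = (\<integral>\<theta>. h \<theta> * indicator C \<theta> \<partial>torus)"
      unfolding set_lebesgue_integral_def g_def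
      by (subst integral_restrict_space) (auto intro!: Bochner_Integration.integral_cong simp: indicator_def)
    then show ?thesis
      using null_spectrum_integral_closed[OF h that] by simp
  qed
  have "(LBINT \<theta>:A. g \<theta>) = 0" if "A \<in> sets borel" for A
  proof -
    have "Int_stable (Collect closed)" "Collect closed \<subseteq> Pow (UNIV :: real set)"
      "A \<in> sigma_sets UNIV (Collect closed)"
      using that by (auto simp: Int_stable_def borel_eq_closed)
    then show ?thesis
    proof (induction A rule: sigma_sets_induct_disjoint)
      case (basic A)
      then show ?case using closed by simp
    next
      case empty
      show ?case by (simp add: set_lebesgue_integral_def)
    next
      case (compl A)
      then have A: "A \<in> sets borel" by (simp add: borel_eq_closed)
      have "(LBINT \<theta>:UNIV. g \<theta>) = (LBINT \<theta>:A. g \<theta>) + (LBINT \<theta>:UNIV - A. g \<theta>)"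
        using A by (subst set_integral_Un[symmetric]) (auto intro: set_int)
      then show ?case using compl closed[of UNIV] by simp
    next
      case (union A)
      then have A: "A i \<in> sets borel" for i by (auto simp: borel_eq_closed)
      have "(LBINT \<theta>:(\<Union>i. A i). g \<theta>) = (\<Sum>i. LBINT \<theta>:A i. g \<theta>)"
        using A union(1) by (intro lebesgue_integral_countable_add)
          (auto simp: disjoint_family_on_def intro!: set_int)
      then show ?case using union by simp
    qed
  qed
  then have "AE \<theta> in lborel. g \<theta> = 0"
    using int_g by (intro sigma_finite_measure.density_zero[OF sigma_finite_lborel]) auto
  then have "AE \<theta> in lborel. \<theta> \<in> {-pi..pi} \<longrightarrow> h \<theta> = 0"
    by eventually_elim (simp add: g_def indicator_def)
  then show ?thesis
    by (simp add: AE_restrict_space_iff)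
qed

section \<open>Limits of multipliers\<close>

definition unit_seq :: "int \<Rightarrow> complex" where
  "unit_seq n = of_bool (n = 0)"

lemma unit_seq_schwartz: "unit_seq \<in> schwartz_Z"
proof -
  have "\<bar>real_of_int n\<bar> ^ k * norm (unit_seq n) < 2" for n k
    by (cases k) (auto simp: unit_seq_def)
  then show ?thesis unfolding schwartz_Z_def by blast
qed

lemma conv_Z_unit_seq: "conv_Z c unit_seq = c"
proof
  fix n
  have "conv_Z c unit_seq n = infsum (\<lambda>m. c (n - m)) {0}"
    unfolding conv_Z_def by (rule infsum_cong_neutral) (auto simp: unit_seq_def)
  then show "conv_Z c unit_seq n = c n" by simp
qed

text \<open>
  Applied to the unit sequence at \<open>0\<close>, the operator returns all Fourier coefficients of its
  multiplier.
\<close>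
corollary has_fourier_multiplier_unique:
  assumes "has_fourier_multiplier T m" "has_fourier_multiplier T m'"
  shows "AE \<theta> in torus. m \<theta> = m' \<theta>"
proof -
  have "integrable torus m" "integrable torus m'" "fourier_coeff m = fourier_coeff m'"
    using assms unit_seq_schwartz unfolding has_fourier_multiplier_iff
    by (auto simp: conv_Z_unit_seq dest!: bspec[OF _ unit_seq_schwartz])
  then have "null_spectrum (\<lambda>\<theta>. m \<theta> - m' \<theta>)"
    by (simp add: null_spectrum_def fourier_coeff_diff)
  from null_spectrum_imp_AE_zero[OF this] show ?thesis by simp
qed

lemma fourier_coeff_cong_AE:
  assumes "integrable torus m" "integrable torus m'" "AE \<theta> in torus. m \<theta> = m' \<theta>"
  shows "fourier_coeff m = fourier_coeff m'"
proof
  fix n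
  have "(\<integral>\<theta>. m \<theta> * cis (- (of_int n * \<theta>)) \<partial>torus) = (\<integral>\<theta>. m' \<theta> * cis (- (of_int n * \<theta>)) \<partial>torus)"
  proof (rule integral_cong_AE)
    show "(\<lambda>\<theta>. m \<theta> * cis (- (of_int n * \<theta>))) \<in> borel_measurable torus"
      by (rule borel_measurable_integrable[OF integrable_torus_mult_cis_minus[OF assms(1)]])
    show "(\<lambda>\<theta>. m' \<theta> * cis (- (of_int n * \<theta>))) \<in> borel_measurable torus"
      by (rule borel_measurable_integrable[OF integrable_torus_mult_cis_minus[OF assms(2)]])
    show "AE \<theta> in torus. m \<theta> * cis (- (of_int n * \<theta>)) = m' \<theta> * cis (- (of_int n * \<theta>))"
      using assms(3) by eventually_elim simp
  qed
  then show "fourier_coeff m n = fourier_coeff m' n" by (simp add: fourier_coeff_def)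
qed

text \<open>
  Any other choice of multipliers agrees with \<open>m \<alpha>\<close> outside a null set that depends on \<open>\<alpha>\<close>. The
  sequence \<open>s\<close> selects countably many parameters, whose exceptional sets have a null union, and
  the limit along \<open>s\<close> already identifies the limit multiplier.
\<close>
theorem multiplier_limit_iff:
  assumes s: "filterlim s F sequentially"
    and m: "\<forall>\<^sub>F \<alpha> in F. has_fourier_multiplier (T \<alpha>) (m \<alpha>)"
    and lim: "AE \<theta> in torus. ((\<lambda>\<alpha>. m \<alpha> \<theta>) \<longlongrightarrow> M \<theta>) F"
    and M: "integrable torus M"
  shows "multiplier_limit T F R \<longleftrightarrow> (\<forall>f\<in>schwartz_Z. R f = conv_Z (fourier_coeff M) f)"
proof
  assume "multiplier_limit T F R"
  then obtain m' M' where m': "\<forall>\<^sub>F \<alpha> in F. has_fourier_multiplier (T \<alpha>) (m' \<alpha>)"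
    and lim': "AE \<theta> in torus. ((\<lambda>\<alpha>. m' \<alpha> \<theta>) \<longlongrightarrow> M' \<theta>) F"
    and M': "has_fourier_multiplier R M'"
    unfolding multiplier_limit_def by (auto simp: AE_restrict_space_iff)
  have "\<forall>\<^sub>F \<alpha> in F. AE \<theta> in torus. m' \<alpha> \<theta> = m \<alpha> \<theta>"
    using m m' by eventually_elim (rule has_fourier_multiplier_unique)
  then have "\<forall>\<^sub>F k in sequentially. AE \<theta> in torus. m' (s k) \<theta> = m (s k) \<theta>"
    using s by (rule eventually_compose_filterlim)
  then obtain K where "\<And>k. k \<ge> K \<Longrightarrow> AE \<theta> in torus. m' (s k) \<theta> = m (s k) \<theta>"
    by (auto simp: eventually_sequentially)
  then have "AE \<theta> in torus. \<forall>k. m' (s (k + K)) \<theta> = m (s (k + K)) \<theta>"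
    by (simp add: AE_all_countable)
  then have "AE \<theta> in torus. M' \<theta> = M \<theta>"
    using lim lim'
  proof eventually_elim
    case (elim \<theta>)
    have "filterlim (\<lambda>k. s (k + K)) F sequentially"
      by (rule filterlim_compose[OF s filterlim_add_const_nat_at_top])
    then have "(\<lambda>k. m (s (k + K)) \<theta>) \<longlonglongrightarrow> M \<theta>" "(\<lambda>k. m' (s (k + K)) \<theta>) \<longlonglongrightarrow> M' \<theta>"
      using elim(2,3) by (auto intro: filterlim_compose)
    with elim(1) show ?case by (simp add: LIMSEQ_unique)
  qed
  then have "fourier_coeff M' = fourier_coeff M"
    using M M' by (intro fourier_coeff_cong_AE) (simp_all add: has_fourier_multiplier_iff)
  with M' show "\<forall>f\<in>schwartz_Z. R f = conv_Z (fourier_coeff M) f"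
    by (simp add: has_fourier_multiplier_iff)
next
  assume "\<forall>f\<in>schwartz_Z. R f = conv_Z (fourier_coeff M) f"
  with M have "has_fourier_multiplier R M" by (simp add: has_fourier_multiplier_iff)
  with m lim show "multiplier_limit T F R"
    unfolding multiplier_limit_def by (auto simp: AE_restrict_space_iff)
qed

section \<open>The multiplier of the discrete heat semigroup\<close>

lemma has_bochner_integral_cis:
  assumes "c \<noteq> 0" "a \<le> b"
  shows "has_bochner_integral lborel (\<lambda>\<theta>. indicator {a..b} \<theta> *\<^sub>R cis (c * \<theta>))
    ((cis (c * b) - cis (c * a)) / (\<i> * of_real c))"
proof -
  have "((\<lambda>\<theta>. cis (c * \<theta>) / (\<i> * of_real c)) has_vector_derivative cis (c * \<theta>)) (at \<theta> within {a..b})" for \<theta>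
  proof -
    have "((\<lambda>\<theta>. exp (\<i> * of_real c * of_real \<theta>)) has_vector_derivative
        exp (\<i> * of_real c * of_real \<theta>) * (\<i> * of_real c)) (at \<theta> within {a..b})"
      by (rule has_vector_derivative_real_field) (auto intro!: derivative_eq_intros)
    from has_vector_derivative_divide[OF this, of "\<i> * of_real c"] assms(1)
    show ?thesis by (simp add: cis_conv_exp mult.assoc)
  qed
  moreover have "continuous_on {a..b} (\<lambda>\<theta>. cis (c * \<theta>))"
    by (intro continuous_intros)
  ultimately show ?thesis
    using has_bochner_integral_FTC_Icc[OF assms(2), of "\<lambda>\<theta>. cis (c * \<theta>) / (\<i> * of_real c)" "\<lambda>\<theta>. cis (c * \<theta>)"]
    by (simp add: diff_divide_distrib)
qed

lemma fourier_coeff_1: "fourier_coeff (\<lambda>_. 1) n = of_bool (n = 0)"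
proof (cases "n = 0")
  case True
  then show ?thesis
    by (simp add: fourier_coeff_def measure_torus scaleR_conv_of_real)
next
  case False
  have "cis (pi * of_int n) = cis (- (pi * of_int n))"
    by (simp add: cis.code sin_times_pi_eq_0 mult.commute)
  then have "(\<integral>\<theta>. indicator {-pi..pi} \<theta> *\<^sub>R cis (- of_int n * \<theta>) \<partial>lborel) = 0"
    using False has_bochner_integral_cis[of "- of_int n" "-pi" pi, THEN has_bochner_integral_integral_eq]
    by (simp add: mult.commute)
  then show ?thesis
    using False by (simp add: fourier_coeff_def integral_restrict_space)
qed

text \<open>
  Fourier inversion for absolutely convergent series: the case \<open>m = 1\<close> of term-by-term
  integration, since the coefficients of \<open>1\<close> are the unit of convolution.
\<close>
lemma fourier_coeff_fourier_Z:
  assumes "summable_Z u"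
  shows "fourier_coeff (fourier_Z u) = u"
proof
  fix n
  have "fourier_coeff (fourier_Z u) n = conv_Z (fourier_coeff (\<lambda>_. 1)) u n"
    using fourier_coeff_mult_fourier_Z[OF _ assms, of "\<lambda>_. 1"] by simp
  also have "\<dots> = infsum u {n}"
    unfolding conv_Z_def by (rule infsum_cong_neutral) (auto simp: fourier_coeff_1)
  finally show "fourier_coeff (fourier_Z u) n = u n" by simp
qed

lemma infsum_int_supported_nat:
  assumes "\<And>n. n < 0 \<Longrightarrow> f n = 0"
  shows "infsum f (UNIV :: int set) = (\<Sum>\<^sub>\<infinity>k. f (int k))"
proof -
  have "n \<in> range int" if "\<not> n < 0" for n
    using that by (intro rev_image_eqI[of "nat n"]) auto
  then have "infsum f UNIV = infsum f (range int)"
    using assms by (intro infsum_cong_neutral) auto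
  also have "\<dots> = (\<Sum>\<^sub>\<infinity>k. f (int k))"
    by (subst infsum_reindex) (auto simp: o_def)
  finally show ?thesis .
qed

lemma infsum_nat_eq_suminf:
  fixes f :: "nat \<Rightarrow> complex"
  assumes "Infinite_Set_Sum.abs_summable_on f UNIV"
  shows "infsum f UNIV = suminf f"
  using assms infsetsum_infsum[OF assms] infsetsum_nat'[OF assms] by simp

text \<open>
  The Fourier coefficients of \<open>exp (y exp (\<i>\<theta>))\<close>. With \<open>y = x / 2\<close>, this sequence and its
  reflection convolve to the Bessel functions \<open>I_n(x)\<close>.
\<close>
definition exp_coeff :: "real \<Rightarrow> int \<Rightarrow> complex" where
  "exp_coeff y n = (if n < 0 then 0 else of_real (y ^ nat n / fact (nat n)))"

lemma summable_exp_coeff: "summable_Z (exp_coeff y)"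
proof -
  have "summable (\<lambda>k. norm (y ^ k /\<^sub>R fact k))"
    by (rule summable_norm_exp)
  then have "summable (\<lambda>k. norm (exp_coeff y (int k)))"
    by (simp add: exp_coeff_def norm_mult norm_inverse norm_power divide_inverse mult.commute abs_mult power_abs)
  then have "Infinite_Set_Sum.abs_summable_on (\<lambda>k. exp_coeff y (int k)) UNIV"
    by (simp add: abs_summable_on_nat_iff')
  then have "Infinite_Set_Sum.abs_summable_on (exp_coeff y) (range int)"
    by (simp add: Infinite_Set_Sum.abs_summable_on_reindex_iff[of int UNIV "exp_coeff y", symmetric])
  moreover have "exp_coeff y n = 0" if "n \<notin> range int" for n
    using that by (cases n) (auto simp: exp_coeff_def)
  ultimately show ?thesis
    by (subst abs_summable_on_cong_neutral[of _ "range int" _ "exp_coeff y"]) auto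
qed

lemma fourier_Z_exp_coeff: "fourier_Z (exp_coeff y) \<theta> = exp (of_real y * cis \<theta>)"
proof -
  have summand: "exp_coeff y (int k) * cis (of_int (int k) * \<theta>) = (of_real y * cis \<theta>) ^ k /\<^sub>R fact k" for k
    by (simp add: exp_coeff_def power_mult_distrib Complex.DeMoivre scaleR_conv_of_real divide_inverse mult_ac)
  have "fourier_Z (exp_coeff y) \<theta> = (\<Sum>\<^sub>\<infinity>k. exp_coeff y (int k) * cis (of_int (int k) * \<theta>))"
    unfolding fourier_Z_def by (rule infsum_int_supported_nat) (simp add: exp_coeff_def)
  also have "\<dots> = (\<Sum>k. (of_real y * cis \<theta>) ^ k /\<^sub>R fact k)"
    unfolding summand
    using summable_norm_exp by (intro infsum_nat_eq_suminf) (simp only: abs_summable_on_nat_iff')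
  finally show ?thesis by (simp add: exp_def)
qed

lemma summable_Z_reflect: "summable_Z u \<Longrightarrow> summable_Z (\<lambda>n. u (- n))"
  by (subst abs_summable_on_reindex_bij_betw[of uminus UNIV UNIV u])
    (auto intro!: bij_betw_byWitness[where f'=uminus])

lemma fourier_Z_reflect: "fourier_Z (\<lambda>n. u (- n)) \<theta> = fourier_Z u (- \<theta>)"
proof -
  have "(\<Sum>\<^sub>\<infinity>n. u (- n) * cis (of_int (- n) * (- \<theta>))) = (\<Sum>\<^sub>\<infinity>n. u n * cis (of_int n * (- \<theta>)))"
    by (rule infsum_reindex_bij_betw[of uminus UNIV UNIV "\<lambda>n. u n * cis (of_int n * (- \<theta>))"])
      (auto intro!: bij_betw_byWitness[where f'=uminus])
  then show ?thesis by (simp add: fourier_Z_def)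
qed

lemma rGamma_plus_one_of_int:
  "rGamma (real_of_int (j + 1)) = (if j < 0 then 0 else 1 / fact (nat j))"
proof (cases "j < 0")
  case True
  then have "real_of_int (j + 1) \<in> \<int>\<^sub>\<le>\<^sub>0" by (intro nonpos_Ints_of_int) simp
  with True show ?thesis by (simp add: rGamma_eq_zero_iff)
next
  case False
  then obtain k where "j = int k" using nonneg_int_cases by (metis not_less)
  then show ?thesis
    using Gamma_fact[of k, where 'a=real] by (simp add: rGamma_inverse_Gamma add.commute inverse_eq_divide)
qed

text \<open>
  With the convention \<open>1 / \<Gamma>(j + 1) = 0\<close> for negative \<open>j\<close>, the formula
  \<open>(x / 2) powi j / \<Gamma>(j + 1)\<close> for \<open>exp_coeff (x / 2) j\<close> is valid for all integers \<open>j\<close>, so the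
  convolution sum is the Bessel series term by term, for negative order as well. Positivity of \<open>x\<close>
  makes the exponent law for \<open>powi\<close> available.
\<close>
lemma bessel_I_eq_conv:
  assumes x: "x > 0"
  shows "complex_of_real (bessel_I n x) = conv_Z (exp_coeff (x / 2)) (\<lambda>m. exp_coeff (x / 2) (- m)) n"
proof -
  define e where "e = exp_coeff (x / 2)"
  have e: "summable_Z e" unfolding e_def by (rule summable_exp_coeff)
  have e_int: "e j = of_real (rGamma (real_of_int (j + 1)) * (x / 2) powi j)" for j
    unfolding rGamma_plus_one_of_int by (simp add: e_def exp_coeff_def power_int_def)
  \<comment> \<open>Being Fourier coefficients, the values of \<open>e\<close> are bounded.\<close>
  have "summable_Z (\<lambda>m. e (n + m) * e m)"
    using e norm_fourier_coeff_le[of "fourier_Z e"] unfolding fourier_coeff_fourier_Z[OF e]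
    by (rule summable_Z_mult_bounded)
  then have "Infinite_Set_Sum.abs_summable_on (\<lambda>m. e (n + m) * e m) (range int)"
    by (rule Infinite_Set_Sum.abs_summable_on_subset) simp
  then have nat_sum: "Infinite_Set_Sum.abs_summable_on (\<lambda>k. e (n + int k) * e (int k)) UNIV"
    by (simp add: Infinite_Set_Sum.abs_summable_on_reindex_iff[of int UNIV "\<lambda>m. e (n + m) * e m", symmetric])
  have summand: "e (n + int k) * e (int k)
      = of_real (rGamma (real_of_int (int k + n + 1)) / fact k * (x / 2) powi (2 * int k + n))" for k
  proof -
    have "(x / 2) powi (2 * int k + n) = (x / 2) powi (n + int k) * (x / 2) ^ k"
      using x by (simp add: power_int_add[symmetric] power_int_of_nat[symmetric] algebra_simps del: power_int_of_nat)
    moreover have "e (int k) = of_real ((x / 2) ^ k / fact k)"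
      by (simp add: e_def exp_coeff_def)
    moreover have "e (n + int k) = of_real (rGamma (real_of_int (int k + n + 1)) * (x / 2) powi (n + int k))"
      unfolding e_int by (simp add: add.commute)
    ultimately show ?thesis by (simp add: mult_ac)
  qed
  have "conv_Z e (\<lambda>m. e (- m)) n = (\<Sum>\<^sub>\<infinity>m. e (n + m) * e m)"
    unfolding conv_Z_def
    by (rule infsum_reindex_bij_witness[of _ uminus uminus]) auto
  also have "\<dots> = (\<Sum>\<^sub>\<infinity>k. e (n + int k) * e (int k))"
    by (rule infsum_int_supported_nat) (simp add: e_def exp_coeff_def)
  also have "\<dots> = (\<Sum>k. e (n + int k) * e (int k))"
    using nat_sum by (rule infsum_nat_eq_suminf)
  also have "\<dots> = complex_of_real (bessel_I n x)"
  proof -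
    have "summable (\<lambda>k. e (n + int k) * e (int k))"
      using nat_sum by (simp add: abs_summable_on_nat_iff' summable_norm_cancel)
    then have "summable (\<lambda>k. rGamma (real_of_int (int k + n + 1)) / fact k * (x / 2) powi (2 * int k + n))"
      unfolding summand summable_complex_of_real .
    then show ?thesis
      unfolding summand bessel_I_def by (simp add: suminf_of_real)
  qed
  finally show ?thesis by (simp add: e_def)
qed

text \<open>
  The multiplier of \<open>-\<Delta>\<close>.
\<close>
definition laplace_symbol :: "real \<Rightarrow> real" where
  "laplace_symbol \<theta> = 4 * (sin (\<theta> / 2))\<^sup>2"

lemma measurable_laplace_symbol [measurable]: "laplace_symbol \<in> borel_measurable borel"
  unfolding laplace_symbol_def by measurable

lemma laplace_symbol_cos: "laplace_symbol \<theta> = 2 - 2 * cos \<theta>"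
  using cos_double_sin[of "\<theta> / 2"] by (simp add: laplace_symbol_def)

lemma laplace_symbol_nonneg: "laplace_symbol \<theta> \<ge> 0"
  by (simp add: laplace_symbol_def)

text \<open>
  Since \<open>laplace_symbol \<theta> = 2 - 2 cos \<theta>\<close>, the function is \<open>exp (- 2 t)\<close> times the generating
  function \<open>exp (2 t cos \<theta>)\<close> of the Bessel functions, which factors into
  \<open>exp (t exp (\<i>\<theta>))\<close> and its conjugate.
\<close>
theorem fourier_coeff_heat_kernel:
  assumes t: "t > 0"
  shows "fourier_coeff (\<lambda>\<theta>. of_real (exp (- t * laplace_symbol \<theta>))) n
    = of_real (exp (- 2 * t) * bessel_I n (2 * t))"
proof -
  define e where "e = exp_coeff t"
  have e: "summable_Z e" unfolding e_def by (rule summable_exp_coeff)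
  have int_e: "integrable torus (fourier_Z e)"
    using integrable_torus_mult_fourier_Z[OF _ e, of "\<lambda>_. 1"] by simp
  have "of_real (exp (- t * laplace_symbol \<theta>))
      = of_real (exp (- 2 * t)) * (fourier_Z e \<theta> * fourier_Z (\<lambda>m. e (- m)) \<theta>)" for \<theta>
  proof -
    have "fourier_Z e \<theta> * fourier_Z (\<lambda>m. e (- m)) \<theta> = exp (of_real t * cis \<theta> + of_real t * cis (- \<theta>))"
      unfolding fourier_Z_reflect e_def fourier_Z_exp_coeff by (simp add: exp_add)
    also have "of_real t * cis \<theta> + of_real t * cis (- \<theta>) = of_real (2 * t * cos \<theta>)"
      by (simp add: complex_eq_iff)
    finally show ?thesis
      by (simp add: laplace_symbol_cos exp_of_real[symmetric] exp_add[symmetric] algebra_simps del: exp_of_real)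
  qed
  then have "fourier_coeff (\<lambda>\<theta>. of_real (exp (- t * laplace_symbol \<theta>))) n
      = of_real (exp (- 2 * t)) * fourier_coeff (\<lambda>\<theta>. fourier_Z e \<theta> * fourier_Z (\<lambda>m. e (- m)) \<theta>) n"
    by (simp add: fourier_coeff_def mult.assoc)
  also have "\<dots> = of_real (exp (- 2 * t)) * conv_Z e (\<lambda>m. e (- m)) n"
    unfolding fourier_coeff_mult_fourier_Z[OF int_e summable_Z_reflect[OF e]] fourier_coeff_fourier_Z[OF e] ..
  finally show ?thesis
    using bessel_I_eq_conv[of "2 * t" n] t by (simp add: e_def)
qed

corollary heat_semigroup_eq:
  assumes "t > 0" "summable_Z f"
  shows "heat_semigroup t f n
    = fourier_coeff (\<lambda>\<theta>. of_real (exp (- t * laplace_symbol \<theta>)) * fourier_Z f \<theta>) n"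
proof -
  have "integrable torus (\<lambda>\<theta>. complex_of_real (exp (- t * laplace_symbol \<theta>)))"
  proof (rule torus.integrable_const_bound[where B=1])
    show "AE \<theta> in torus. norm (complex_of_real (exp (- t * laplace_symbol \<theta>))) \<le> 1"
      using assms(1) laplace_symbol_nonneg by simp
    show "(\<lambda>\<theta>. complex_of_real (exp (- t * laplace_symbol \<theta>))) \<in> borel_measurable torus"
      by (rule measurable_torus) measurable
  qed
  then have "fourier_coeff (\<lambda>\<theta>. of_real (exp (- t * laplace_symbol \<theta>)) * fourier_Z f \<theta>) n
      = conv_Z (fourier_coeff (\<lambda>\<theta>. of_real (exp (- t * laplace_symbol \<theta>)))) f n"
    using assms(2) by (simp only: fourier_coeff_mult_fourier_Z)
  then show ?thesis
    unfolding heat_semigroup_def conv_Z_def fourier_coeff_heat_kernel[OF assms(1)] by simp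
qed

section \<open>The multiplier of the discrete fractional integral\<close>

text \<open>
  Euler's integral after the substitution \<open>t \<mapsto> \<mu> t\<close>: averaging \<open>exp (- t \<mu>)\<close> over \<open>t\<close> produces the
  power \<open>\<mu> powr - \<alpha>\<close>, which is how the heat semigroup generates fractional powers.
\<close>
lemma has_bochner_integral_Gamma_scaled:
  fixes \<alpha> \<mu> :: real
  assumes "\<alpha> > 0" "\<mu> > 0"
  shows "has_bochner_integral lborel
    (\<lambda>t. indicator {0<..} t * (exp (- t * \<mu>) * t powr \<alpha> / t)) (Gamma \<alpha> * \<mu> powr - \<alpha>)"
proof -
  have "has_bochner_integral lborel (\<lambda>t. indicator {0..} t * t powr (\<alpha> - 1) / exp t) (Gamma \<alpha>)"
  proof (rule has_bochner_integral_nn_integral)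
    show "(\<integral>\<^sup>+t. ennreal (indicator {0..} t * t powr (\<alpha> - 1) / exp t) \<partial>lborel) = ennreal (Gamma \<alpha>)"
      using Gamma_conv_nn_integral_real[OF assms(1)] by simp
    show "0 \<le> Gamma \<alpha>" using assms(1) by (simp add: Gamma_real_nonneg)
  qed auto
  then have "has_bochner_integral lborel
      (\<lambda>t. indicator {0..} (0 + \<mu> * t) * (0 + \<mu> * t) powr (\<alpha> - 1) / exp (0 + \<mu> * t)) (Gamma \<alpha> /\<^sub>R \<bar>\<mu>\<bar>)"
    using assms(2) by (subst (asm) lborel_has_bochner_integral_real_affine_iff[of \<mu> _ _ 0]) auto
  then have "has_bochner_integral lborel
      (\<lambda>t. \<mu> powr (1 - \<alpha>) * (indicator {0..} (\<mu> * t) * (\<mu> * t) powr (\<alpha> - 1) / exp (\<mu> * t)))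
      (\<mu> powr (1 - \<alpha>) * (Gamma \<alpha> / \<mu>))"
    using assms(2) by (intro has_bochner_integral_mult_right) (simp add: divide_inverse mult.commute)
  moreover have "\<mu> powr (1 - \<alpha>) * (indicator {0..} (\<mu> * t) * (\<mu> * t) powr (\<alpha> - 1) / exp (\<mu> * t))
      = indicator {0<..} t * (exp (- t * \<mu>) * t powr \<alpha> / t)" for t
  proof (cases "t > 0")
    case True
    have "\<mu> powr (1 - \<alpha>) * (\<mu> * t) powr (\<alpha> - 1) = t powr (\<alpha> - 1)"
      using True assms(2) by (simp add: powr_mult mult.assoc[symmetric] powr_add[symmetric])
    then show ?thesis
      using True assms(2) by (simp add: powr_diff exp_minus field_simps)
  next
    case False
    then show ?thesis using assms(2) by (cases "t = 0") (auto simp: indicator_def zero_le_mult_iff)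
  qed
  moreover have "\<mu> powr (1 - \<alpha>) * (Gamma \<alpha> / \<mu>) = Gamma \<alpha> * \<mu> powr - \<alpha>"
    using assms(2) by (simp add: powr_diff powr_minus field_simps)
  ultimately show ?thesis by simp
qed

text \<open>
  The constant is not optimal. Halving the angle brings it below \<open>pi / 3\<close>, where the cosine is at
  least \<open>1 / 2\<close>; the mean value theorem and the double-angle formula do the rest.
\<close>
lemma sin_lower_bound:
  assumes "0 \<le> x" "x \<le> pi / 2"
  shows "x / 4 \<le> sin x"
proof -
  define y where "y = x / 2"
  have y: "0 \<le> y" "y \<le> pi / 3" using assms by (auto simp: y_def)
  have cos_ge: "cos z \<ge> 1 / 2" if "0 \<le> z" "z \<le> y" for z
    using cos_monotone_0_pi_le[of z "pi / 3"] that y by (simp add: cos_60)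
  have "y / 2 \<le> sin y"
  proof (cases "y = 0")
    case False
    then obtain z where "0 < z" "z < y" "sin y - sin 0 = (y - 0) * cos z"
      using MVT2[of 0 y sin cos] y by auto
    then show ?thesis using cos_ge[of z] y mult_left_mono[of "1 / 2" "cos z" y] by simp
  qed simp
  then have "y / 2 * (1 / 2) \<le> sin y * cos y"
    using cos_ge[of y] y by (intro mult_mono) auto
  moreover have "sin x = 2 * (sin y * cos y)"
    using sin_double[of y] by (simp add: y_def)
  ultimately show ?thesis by (simp add: y_def)
qed

lemma laplace_symbol_lower_bound:
  assumes "\<theta> \<in> {-pi..pi}"
  shows "(\<bar>\<theta>\<bar> / 4)\<^sup>2 \<le> laplace_symbol \<theta>"
proof -
  have "\<bar>\<theta>\<bar> / 8 \<le> sin (\<bar>\<theta>\<bar> / 2)"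
    using sin_lower_bound[of "\<bar>\<theta>\<bar> / 2"] assms by auto
  then have "(\<bar>\<theta>\<bar> / 8)\<^sup>2 \<le> (sin (\<bar>\<theta>\<bar> / 2))\<^sup>2"
    by (intro power_mono) auto
  moreover have "(sin (\<bar>\<theta>\<bar> / 2))\<^sup>2 = (sin (\<theta> / 2))\<^sup>2"
    by (cases "\<theta> \<ge> 0") auto
  ultimately show ?thesis
    by (simp add: laplace_symbol_def power_divide)
qed

lemma laplace_symbol_pos:
  assumes "\<theta> \<in> {-pi..pi}" "\<theta> \<noteq> 0"
  shows "laplace_symbol \<theta> > 0"
proof -
  have "0 < (\<bar>\<theta>\<bar> / 4)\<^sup>2" using assms(2) by simp
  then show ?thesis using laplace_symbol_lower_bound[OF assms(1)] by linarith
qed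

lemma AE_torus_laplace_symbol_pos: "AE \<theta> in torus. laplace_symbol \<theta> > 0"
proof -
  have "AE \<theta> in lborel. \<theta> \<in> {-pi..pi} \<longrightarrow> laplace_symbol \<theta> > 0"
    using AE_lborel_singleton[of "0 :: real"] by eventually_elim (blast intro: laplace_symbol_pos)
  then show ?thesis
    by (subst AE_restrict_space_iff) simp_all
qed

lemma integrable_torus_abs_powr:
  assumes "a > - 1"
  shows "integrable torus (\<lambda>\<theta>. \<bar>\<theta>\<bar> powr a)"
proof -
  have half: "integrable lborel (\<lambda>\<theta>. indicator {0..pi} \<theta> * \<theta> powr a)"
  proof -
    have hi: "((\<lambda>\<theta>. \<theta> powr a) has_integral integral {0..pi} (\<lambda>\<theta>. \<theta> powr a)) {0..pi}"
      using integrable_on_powr_from_0[OF assms, of pi] by (simp add: has_integral_iff)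
    have "has_bochner_integral lborel (\<lambda>\<theta>. indicator {0..pi} \<theta> * \<theta> powr a) (integral {0..pi} (\<lambda>\<theta>. \<theta> powr a))"
    proof (rule has_bochner_integral_nn_integral)
      show "(\<integral>\<^sup>+\<theta>. ennreal (indicator {0..pi} \<theta> * \<theta> powr a) \<partial>lborel) = ennreal (integral {0..pi} (\<lambda>\<theta>. \<theta> powr a))"
        using nn_integral_has_integral_lebesgue[OF _ hi] by simp
      show "0 \<le> integral {0..pi} (\<lambda>\<theta>. \<theta> powr a)"
        using has_integral_nonneg[OF hi] by simp
    qed auto
    then show ?thesis by (simp add: has_bochner_integral_iff)
  qed
  have "integrable lborel (\<lambda>\<theta>. indicator {0..pi} (0 + - 1 * \<theta>) * (0 + - 1 * \<theta>) powr a)"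
    using half by (rule lborel_integrable_real_affine) simp
  with half have "integrable lborel (\<lambda>\<theta>. indicator {0..pi} \<theta> * \<theta> powr a + indicator {0..pi} (- \<theta>) * (- \<theta>) powr a)"
    by simp
  moreover have "indicator {0..pi} \<theta> * \<theta> powr a + indicator {0..pi} (- \<theta>) * (- \<theta>) powr a
      = indicator {-pi..pi} \<theta> *\<^sub>R \<bar>\<theta>\<bar> powr a" for \<theta> :: real
    by (cases "\<theta> = 0"; cases "\<theta> > 0") (auto simp: indicator_def)
  ultimately show ?thesis
    by (simp add: integrable_restrict_space)
qed

lemma measurable_torus_laplace_symbol [measurable]: "laplace_symbol \<in> borel_measurable torus"
  by (rule measurable_torus) measurable

text \<open>
  The threshold \<open>1 / 2\<close> of the fractional integral appears here: the singularity at \<open>0\<close> is of order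
  \<open>\<bar>\<theta>\<bar> powr (- 2\<alpha>)\<close>.
\<close>
lemma integrable_torus_laplace_symbol_powr:
  assumes "0 < \<alpha>" "\<alpha> < 1 / 2"
  shows "integrable torus (\<lambda>\<theta>. laplace_symbol \<theta> powr - \<alpha>)"
proof (rule Bochner_Integration.integrable_bound)
  show "integrable torus (\<lambda>\<theta>. 4 powr (2 * \<alpha>) * \<bar>\<theta>\<bar> powr (- 2 * \<alpha>))"
    using assms by (intro integrable_mult_right integrable_torus_abs_powr) simp
  show "(\<lambda>\<theta>. laplace_symbol \<theta> powr - \<alpha>) \<in> borel_measurable torus"
    by measurable
  have "norm (laplace_symbol \<theta> powr - \<alpha>) \<le> norm (4 powr (2 * \<alpha>) * \<bar>\<theta>\<bar> powr (- 2 * \<alpha>))"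
    if "\<theta> \<in> {-pi..pi}" for \<theta>
  proof (cases "\<theta> = 0")
    case False
    have "laplace_symbol \<theta> powr - \<alpha> \<le> ((\<bar>\<theta>\<bar> / 4)\<^sup>2) powr - \<alpha>"
      using laplace_symbol_lower_bound[OF that] assms False by (intro powr_mono2') auto
    also have "\<dots> = (\<bar>\<theta>\<bar> / 4) powr (- 2 * \<alpha>)"
      using False by (simp add: powr_powr flip: powr_numeral)
    also have "\<dots> = 4 powr (2 * \<alpha>) * \<bar>\<theta>\<bar> powr (- 2 * \<alpha>)"
      using False by (simp add: powr_divide powr_minus field_simps)
    finally show ?thesis by simp
  qed (simp add: laplace_symbol_def)
  then show "AE \<theta> in torus. norm (laplace_symbol \<theta> powr - \<alpha>) \<le> norm (4 powr (2 * \<alpha>) * \<bar>\<theta>\<bar> powr (- 2 * \<alpha>))"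
    by (intro AE_I2) (simp add: space_restrict_space)
qed

text \<open>
  Both sides are iterated integrals of the heat multiplier over \<open>t > 0\<close> and \<open>\<theta>\<close>. Integrating the
  absolute value in \<open>t\<close> first leaves \<open>\<Gamma>(\<alpha>)\<close> times an integrable function of \<open>\<theta>\<close>, so the order
  may be exchanged. At \<open>\<theta> = 0\<close> the inner integral diverges, but this single point is a
  null set.
\<close>
theorem frac_integral_eq:
  assumes \<alpha>: "0 < \<alpha>" "\<alpha> < 1 / 2" and f: "summable_Z f"
  shows "frac_integral \<alpha> f n = fourier_coeff (\<lambda>\<theta>. of_real (laplace_symbol \<theta> powr - \<alpha>) * fourier_Z f \<theta>) n"
proof -
  define w where "w \<mu> t = indicator {0<..} t * (exp (- t * \<mu>) * t powr \<alpha> / t)" for \<mu> t :: real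
  define G where "G \<theta> = fourier_Z f \<theta> * cis (- (of_int n * \<theta>))" for \<theta>
  define K where "K = (\<lambda>(\<theta>, t). complex_of_real (w (laplace_symbol \<theta>) t) * G \<theta>)"
  interpret P: pair_sigma_finite torus lborel ..
  have [measurable]: "fourier_Z f \<in> borel_measurable torus"
    using f by (rule measurable_fourier_Z)
  have [measurable]: "(\<lambda>\<theta>. cis (- (of_int n * \<theta>))) \<in> borel_measurable torus"
    by (rule measurable_torus) measurable
  have G_meas [measurable]: "G \<in> borel_measurable torus"
    unfolding G_def by measurable
  have G_bound: "norm (G \<theta>) \<le> (\<integral>n. norm (f n) \<partial>count_space UNIV)" for \<theta>
    using norm_fourier_Z_le[OF f] by (simp add: G_def norm_mult)
  have int_powr: "integrable torus (\<lambda>\<theta>. complex_of_real (laplace_symbol \<theta> powr - \<alpha>) * G \<theta>)"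
    using integrable_torus_laplace_symbol_powr[OF \<alpha>] G_meas G_bound
    by (intro integrable_torus_mult_bounded) auto
  have w_nonneg: "w \<mu> t \<ge> 0" for \<mu> t
    by (auto simp: w_def indicator_def)
  have w_int: "has_bochner_integral lborel (w \<mu>) (Gamma \<alpha> * \<mu> powr - \<alpha>)" if "\<mu> > 0" for \<mu>
    unfolding w_def using \<alpha>(1) that by (rule has_bochner_integral_Gamma_scaled)
  have K_int: "has_bochner_integral lborel (\<lambda>t. K (\<theta>, t)) (of_real (Gamma \<alpha>) * (of_real (laplace_symbol \<theta> powr - \<alpha>) * G \<theta>))"
    if "laplace_symbol \<theta> > 0" for \<theta>
    using has_bochner_integral_mult_left[OF has_bochner_integral_of_real[OF w_int[OF that]], of "G \<theta>"]
    by (simp add: K_def mult.assoc)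
  have "integrable (torus \<Otimes>\<^sub>M lborel) K"
  proof (rule P.Fubini_integrable)
    show "K \<in> borel_measurable (torus \<Otimes>\<^sub>M lborel)"
      unfolding K_def w_def by measurable
    have "AE \<theta> in torus. Gamma \<alpha> * norm (complex_of_real (laplace_symbol \<theta> powr - \<alpha>) * G \<theta>)
        = (\<integral>t. norm (K (\<theta>, t)) \<partial>lborel)"
      using AE_torus_laplace_symbol_pos
    proof eventually_elim
      case (elim \<theta>)
      have "(\<integral>t. norm (K (\<theta>, t)) \<partial>lborel) = (\<integral>t. w (laplace_symbol \<theta>) t * norm (G \<theta>) \<partial>lborel)"
        using w_nonneg by (simp add: K_def norm_mult)
      then show ?case
        using w_int[OF elim] by (simp add: has_bochner_integral_integral_eq norm_mult)
    qed
    moreover have "integrable torus (\<lambda>\<theta>. Gamma \<alpha> * norm (complex_of_real (laplace_symbol \<theta> powr - \<alpha>) * G \<theta>))"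
      using int_powr by (intro integrable_mult_right integrable_norm)
    ultimately show "integrable torus (\<lambda>\<theta>. \<integral>t. norm (K (\<theta>, t)) \<partial>lborel)"
      by (rule integrable_cong_AE_imp[rotated 2]) (unfold K_def w_def, measurable)
    show "AE \<theta> in torus. integrable lborel (\<lambda>t. K (\<theta>, t))"
      using AE_torus_laplace_symbol_pos by eventually_elim (use K_int in \<open>auto simp: has_bochner_integral_iff\<close>)
  qed
  then have "(\<integral>t. (\<integral>\<theta>. K (\<theta>, t) \<partial>torus) \<partial>lborel) = (\<integral>\<theta>. (\<integral>t. K (\<theta>, t) \<partial>lborel) \<partial>torus)"
    by (intro P.Fubini_integral) simp
  also have "\<dots> = (\<integral>\<theta>. of_real (Gamma \<alpha>) * (of_real (laplace_symbol \<theta> powr - \<alpha>) * G \<theta>) \<partial>torus)"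
  proof (rule integral_cong_AE)
    show "(\<lambda>\<theta>. \<integral>t. K (\<theta>, t) \<partial>lborel) \<in> borel_measurable torus"
      unfolding K_def w_def by measurable
    show "AE \<theta> in torus. (\<integral>t. K (\<theta>, t) \<partial>lborel) = of_real (Gamma \<alpha>) * (of_real (laplace_symbol \<theta> powr - \<alpha>) * G \<theta>)"
      using AE_torus_laplace_symbol_pos by eventually_elim (use K_int in \<open>auto simp: has_bochner_integral_iff\<close>)
  qed measurable
  also have "\<dots> = of_real (Gamma \<alpha>) * (2 * of_real pi)
      * fourier_coeff (\<lambda>\<theta>. of_real (laplace_symbol \<theta> powr - \<alpha>) * fourier_Z f \<theta>) n"
    by (simp add: fourier_coeff_def G_def mult.assoc)
  finally have main: "(\<integral>t. (\<integral>\<theta>. K (\<theta>, t) \<partial>torus) \<partial>lborel) = \<dots>" .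
  have "(\<integral>\<theta>. K (\<theta>, t) \<partial>torus)
      = 2 * of_real pi * (indicator {0<..} t *\<^sub>R (heat_semigroup t f n * of_real (t powr \<alpha>) / of_real t))" for t
  proof (cases "t > 0")
    case True
    have "(\<integral>\<theta>. K (\<theta>, t) \<partial>torus) = (\<integral>\<theta>. of_real (t powr \<alpha> / t) *
        (of_real (exp (- t * laplace_symbol \<theta>)) * fourier_Z f \<theta> * cis (- (of_int n * \<theta>))) \<partial>torus)"
      using True by (simp add: K_def w_def G_def mult_ac)
    also have "\<dots> = of_real (t powr \<alpha> / t) * (2 * of_real pi * heat_semigroup t f n)"
      unfolding heat_semigroup_eq[OF True f] by (simp add: fourier_coeff_def)
    finally show ?thesis using True by simp
  next
    case False
    then show ?thesis by (simp add: K_def w_def)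
  qed
  then have "(\<integral>t. (\<integral>\<theta>. K (\<theta>, t) \<partial>torus) \<partial>lborel)
      = 2 * of_real pi * (LBINT t:{0<..}. heat_semigroup t f n * of_real (t powr \<alpha>) / of_real t)"
    by (simp only: set_lebesgue_integral_def integral_mult_right_zero)
  with main have "(LBINT t:{0<..}. heat_semigroup t f n * of_real (t powr \<alpha>) / of_real t)
      = of_real (Gamma \<alpha>) * fourier_coeff (\<lambda>\<theta>. of_real (laplace_symbol \<theta> powr - \<alpha>) * fourier_Z f \<theta>) n"
    by simp
  moreover have "Gamma \<alpha> \<noteq> 0" using Gamma_real_pos[OF \<alpha>(1)] by simp
  ultimately show ?thesis by (simp add: frac_integral_def)
qed

lemma has_fourier_multiplierI:
  assumes "integrable torus m"
    and "\<And>f. f \<in> schwartz_Z \<Longrightarrow> T f = fourier_coeff (\<lambda>\<theta>. m \<theta> * fourier_Z f \<theta>)"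
  shows "has_fourier_multiplier T m"
  using assms by (simp add: has_fourier_multiplier_iff fourier_coeff_mult_fourier_Z schwartz_Z_abs_summable)

lemma integrable_torus_symbol_mult:
  assumes "0 < \<alpha>" "\<alpha> < 1 / 2" "summable_Z f"
  shows "integrable torus (\<lambda>\<theta>. complex_of_real (laplace_symbol \<theta> powr - \<alpha>) * fourier_Z f \<theta>)"
  using integrable_torus_laplace_symbol_powr[OF assms(1,2)] assms(3)
  by (intro integrable_torus_mult_fourier_Z) auto

section \<open>The Riesz transforms\<close>

text \<open>
  For \<open>0 < \<alpha> < 1 / 2\<close> this is the multiplier of \<open>D (-\<Delta>) powr - \<alpha>\<close>. At the endpoint \<open>1 / 2\<close> it is the
  multiplier of the limit, although the fractional integral alone is no longer defined there.
\<close>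
definition riesz_symbol :: "real \<Rightarrow> real \<Rightarrow> complex" where
  "riesz_symbol \<alpha> \<theta> = (cis (- \<theta>) - 1) * of_real (laplace_symbol \<theta> powr - \<alpha>)"

lemma fwd_diff_fourier_coeff:
  assumes "integrable torus g"
  shows "fwd_diff (fourier_coeff g) = fourier_coeff (\<lambda>\<theta>. (cis (- \<theta>) - 1) * g \<theta>)"
proof
  fix n
  have "fourier_coeff (\<lambda>\<theta>. (cis (- \<theta>) - 1) * g \<theta>) n
      = fourier_coeff (\<lambda>\<theta>. g \<theta> * cis (of_int (- 1) * \<theta>) - g \<theta>) n"
    by (simp add: algebra_simps)
  also have "\<dots> = fourier_coeff g (n - (- 1)) - fourier_coeff g n"
    using assms by (subst fourier_coeff_diff) (simp_all only: fourier_coeff_mult_cis integrable_torus_mult_cis)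
  finally show "fwd_diff (fourier_coeff g) n = fourier_coeff (\<lambda>\<theta>. (cis (- \<theta>) - 1) * g \<theta>) n"
    by (simp add: fwd_diff_def)
qed

lemma integrable_riesz_symbol:
  assumes "0 < \<alpha>" "\<alpha> < 1 / 2"
  shows "integrable torus (riesz_symbol \<alpha>)"
proof -
  have "integrable torus (\<lambda>\<theta>. complex_of_real (laplace_symbol \<theta> powr - \<alpha>) * cis ((- 1) * \<theta>)
      - complex_of_real (laplace_symbol \<theta> powr - \<alpha>))"
    using integrable_torus_laplace_symbol_powr[OF assms]
    by (intro Bochner_Integration.integrable_diff integrable_torus_mult_cis) auto
  then show ?thesis by (simp add: riesz_symbol_def[abs_def] algebra_simps)
qed

lemma fwd_diff_frac_integral_multiplier:
  assumes "0 < \<alpha>" "\<alpha> < 1 / 2"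
  shows "has_fourier_multiplier (\<lambda>f. fwd_diff (frac_integral \<alpha> f)) (riesz_symbol \<alpha>)"
proof (rule has_fourier_multiplierI)
  fix f assume "f \<in> schwartz_Z"
  then have f: "summable_Z f" by (rule schwartz_Z_abs_summable)
  have "frac_integral \<alpha> f = fourier_coeff (\<lambda>\<theta>. of_real (laplace_symbol \<theta> powr - \<alpha>) * fourier_Z f \<theta>)"
    using frac_integral_eq[OF assms f] by blast
  then show "fwd_diff (frac_integral \<alpha> f) = fourier_coeff (\<lambda>\<theta>. riesz_symbol \<alpha> \<theta> * fourier_Z f \<theta>)"
    using fwd_diff_fourier_coeff[OF integrable_torus_symbol_mult[OF assms f]]
    by (simp add: riesz_symbol_def mult.assoc)
qed (rule integrable_riesz_symbol[OF assms])

lemma conv_Z_shift: "conv_Z (\<lambda>n. g (n - 1)) f n = conv_Z g f (n - 1)"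
  by (simp add: conv_Z_def algebra_simps)

lemma bwd_diff_eq_fwd_diff: "bwd_diff f n = fwd_diff f (n - 1)"
  by (simp add: bwd_diff_def fwd_diff_def)

lemma fourier_coeff_mult_cis_1: "fourier_coeff (\<lambda>\<theta>. m \<theta> * cis \<theta>) = (\<lambda>n. fourier_coeff m (n - 1))"
  using fourier_coeff_mult_cis[of m 1] by (simp add: fun_eq_iff)

lemma integrable_torus_mult_cis_1: "integrable torus m \<Longrightarrow> integrable torus (\<lambda>\<theta>. m \<theta> * cis \<theta>)"
  using integrable_torus_mult_cis[of m 1] by simp

lemma has_fourier_multiplier_shift:
  assumes "has_fourier_multiplier T m"
  shows "has_fourier_multiplier (\<lambda>f n. T f (n - 1)) (\<lambda>\<theta>. m \<theta> * cis \<theta>)"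
  using assms
  by (simp add: has_fourier_multiplier_iff integrable_torus_mult_cis_1 fourier_coeff_mult_cis_1 conv_Z_shift fun_eq_iff)

lemma bwd_diff_frac_integral_multiplier:
  assumes "0 < \<alpha>" "\<alpha> < 1 / 2"
  shows "has_fourier_multiplier (\<lambda>f. bwd_diff (frac_integral \<alpha> f)) (\<lambda>\<theta>. riesz_symbol \<alpha> \<theta> * cis \<theta>)"
  using has_fourier_multiplier_shift[OF fwd_diff_frac_integral_multiplier[OF assms]]
  by (simp add: bwd_diff_eq_fwd_diff[abs_def])

text \<open>
  The difference contributes \<open>exp (-\<i>\<theta>) - 1 = - 2 \<i> sin (\<theta> / 2) exp (-\<i>\<theta> / 2)\<close>, and the
  symbol of the square root is \<open>2 \<bar>sin (\<theta> / 2)\<bar>\<close>, so only a sign and a phase remain.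
\<close>
lemma riesz_symbol_half:
  assumes "\<theta> \<in> {-pi..pi}"
  shows "riesz_symbol (1 / 2) \<theta> = - \<i> * of_real (sgn \<theta>) * cis (- (\<theta> / 2))"
proof (cases "\<theta> = 0")
  case False
  have "(2 * \<bar>sin (\<theta> / 2)\<bar>)\<^sup>2 = laplace_symbol \<theta>"
    by (simp add: laplace_symbol_def power_mult_distrib)
  then have "laplace_symbol \<theta> powr (1 / 2) = 2 * \<bar>sin (\<theta> / 2)\<bar>"
    by (metis abs_ge_zero laplace_symbol_nonneg mult_nonneg_nonneg powr_half_sqrt real_sqrt_unique zero_le_numeral)
  then have powr: "laplace_symbol \<theta> powr - (1 / 2) = 1 / (2 * \<bar>sin (\<theta> / 2)\<bar>)"
    by (simp add: powr_minus inverse_eq_divide)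
  have sin_nz: "sin (\<theta> / 2) \<noteq> 0"
    using laplace_symbol_pos[OF assms False] by (auto simp: laplace_symbol_def)
  have sgn: "sgn (sin (\<theta> / 2)) = sgn \<theta>"
  proof (cases "\<theta> > 0")
    case True
    then show ?thesis using assms sin_gt_zero[of "\<theta> / 2"] by auto
  next
    case False
    then show ?thesis using assms \<open>\<theta> \<noteq> 0\<close> sin_gt_zero[of "- \<theta> / 2"] by auto
  qed
  have "cis (- \<theta>) - 1 = cis (- (\<theta> / 2)) * (cis (- (\<theta> / 2)) - cis (\<theta> / 2))"
    by (simp add: right_diff_distrib cis_mult)
  also have "cis (- (\<theta> / 2)) - cis (\<theta> / 2) = - 2 * \<i> * of_real (sin (\<theta> / 2))"
    by (simp add: complex_eq_iff)
  finally have "riesz_symbol (1 / 2) \<theta>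
      = - \<i> * of_real (sin (\<theta> / 2) / \<bar>sin (\<theta> / 2)\<bar>) * cis (- (\<theta> / 2))"
    by (simp add: riesz_symbol_def powr)
  also have "sin (\<theta> / 2) / \<bar>sin (\<theta> / 2)\<bar> = sgn \<theta>"
    unfolding sgn[symmetric] by (simp add: real_sgn_eq)
  finally show ?thesis .
qed (simp add: riesz_symbol_def)

lemma riesz_symbol_tendsto: "((\<lambda>\<alpha>. riesz_symbol \<alpha> \<theta>) \<longlongrightarrow> riesz_symbol (1 / 2) \<theta>) (at_left (1 / 2))"
proof (cases "laplace_symbol \<theta> = 0")
  case False
  then show ?thesis
    unfolding riesz_symbol_def
    by (intro tendsto_mult tendsto_of_real tendsto_powr tendsto_const tendsto_minus tendsto_ident_at)
qed (simp add: riesz_symbol_def)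

text \<open>
  The half-integer frequency \<open>s = n + 1 / 2\<close> comes from the phase \<open>exp (-\<i>\<theta> / 2)\<close>. The sign change
  at \<open>0\<close> makes the two half-intervals contribute \<open>exp (\<plusminus>\<i>s pi) - 1\<close>, and the boundary terms at
  \<open>\<plusminus>pi\<close> cancel because \<open>cos (s pi) = 0\<close>.
\<close>
lemma riesz_kernel:
  "integrable torus (riesz_symbol (1 / 2))"
  "fourier_coeff (riesz_symbol (1 / 2)) n = - complex_of_real (1 / (pi * (of_int n + 1 / 2)))"
proof -
  define E where "E n a b \<theta> = indicator {a..b} \<theta> *\<^sub>R cis (- (of_int n + 1 / 2) * \<theta>)" for n :: int and a b \<theta> :: real
  have nz: "- (of_int n + 1 / 2) \<noteq> (0 :: real)" for n :: int
  proof
    assume "- (of_int n + 1 / 2) = (0 :: real)"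
    then have "real_of_int (2 * n + 1) = real_of_int 0" by simp
    then show False by presburger
  qed
  have E: "has_bochner_integral lborel (E n a b)
      ((cis (- (of_int n + 1 / 2) * b) - cis (- (of_int n + 1 / 2) * a)) / (\<i> * of_real (- (of_int n + 1 / 2))))"
    if "a \<le> b" for n a b
    unfolding E_def using nz that by (rule has_bochner_integral_cis)
  \<comment> \<open>This holds also at \<open>0\<close>, where both terms on the right are \<open>1\<close> and \<open>sgn 0 = 0\<close>.\<close>
  have split: "indicator {-pi..pi} \<theta> *\<^sub>R (riesz_symbol (1 / 2) \<theta> * cis (- (of_int n * \<theta>)))
      = - \<i> * (E n 0 pi \<theta> - E n (- pi) 0 \<theta>)" for \<theta> and n :: int
  proof (cases "\<theta> \<in> {-pi..pi}")
    case True
    have "cis (- (\<theta> / 2)) * cis (- (of_int n * \<theta>)) = cis (- (of_int n + 1 / 2) * \<theta>)"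
      by (simp add: cis_mult algebra_simps)
    then have "riesz_symbol (1 / 2) \<theta> * cis (- (of_int n * \<theta>)) = - \<i> * of_real (sgn \<theta>) * cis (- (of_int n + 1 / 2) * \<theta>)"
      unfolding riesz_symbol_half[OF True] by (simp only: mult.assoc)
    then show ?thesis
      using True by (cases "\<theta> = 0"; cases "\<theta> > 0") (auto simp: E_def)
  qed (auto simp: E_def)
  have "integrable lborel (\<lambda>\<theta>. indicator {-pi..pi} \<theta> *\<^sub>R (riesz_symbol (1 / 2) \<theta> * cis (- (of_int 0 * \<theta>))))"
    unfolding split
    by (intro integrable_mult_right Bochner_Integration.integrable_diff integrable.intros[OF E]) auto
  then show "integrable torus (riesz_symbol (1 / 2))"
    by (simp add: integrable_restrict_space)
  define s where "s = real_of_int n + 1 / 2"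
  have s: "s \<noteq> 0" using nz[of n] by (auto simp: s_def)
  have "cos (s * pi) = 0"
    by (simp add: s_def distrib_right cos_add sin_times_pi_eq_0)
  then have cis_s: "cis (s * pi) + cis (- (s * pi)) = 0"
    by (simp add: complex_eq_iff)
  have "(\<integral>\<theta>. riesz_symbol (1 / 2) \<theta> * cis (- (of_int n * \<theta>)) \<partial>torus) = (\<integral>\<theta>. - \<i> * (E n 0 pi \<theta> - E n (- pi) 0 \<theta>) \<partial>lborel)"
    by (simp only: split[symmetric]) (simp add: integral_restrict_space)
  also have "\<dots> = - \<i> * ((cis (- s * pi) - cis (- s * 0)) / (\<i> * of_real (- s)) - (cis (- s * 0) - cis (- s * (- pi))) / (\<i> * of_real (- s)))"
    unfolding s_def
    by (intro has_bochner_integral_integral_eq has_bochner_integral_mult_right has_bochner_integral_diff E) auto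
  also have "\<dots> = (cis (s * pi) + cis (- (s * pi)) - 2) / of_real s"
    using s by (simp add: field_simps)
  also have "\<dots> = - 2 / of_real s" unfolding cis_s by simp
  finally show "fourier_coeff (riesz_symbol (1 / 2)) n = - complex_of_real (1 / (pi * (of_int n + 1 / 2)))"
    unfolding fourier_coeff_def s_def[symmetric] by simp
qed

theorem proposition5:
  fixes R R' :: "(int \<Rightarrow> complex) \<Rightarrow> int \<Rightarrow> complex"
  shows
    "(multiplier_limit (\<lambda>\<alpha> f. fwd_diff (frac_integral \<alpha> f)) (at_left (1/2)) R \<longleftrightarrow>
       (\<forall>f\<in>schwartz_Z. R f =
          conv_Z (\<lambda>n. - complex_of_real (1 / (pi * (of_int n + 1/2)))) f)) \<and>
     (multiplier_limit (\<lambda>\<alpha> f. bwd_diff (frac_integral \<alpha> f)) (at_left (1/2)) R' \<longleftrightarrow>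
       (\<forall>f\<in>schwartz_Z. R' f =
          conv_Z (\<lambda>n. - complex_of_real (1 / (pi * (of_int n - 1/2)))) f))"
proof -
  have s: "filterlim (\<lambda>k. 1 / 2 - 1 / real (Suc k)) (at_left (1 / 2 :: real)) sequentially"
  proof (rule tendsto_imp_filterlim_at_left)
    show "(\<lambda>k. 1 / 2 - 1 / real (Suc k)) \<longlonglongrightarrow> 1 / 2"
      using tendsto_diff[OF tendsto_const LIMSEQ_Suc[OF lim_1_over_n], of "1 / 2 :: real"] by simp
  qed simp
  have near: "\<forall>\<^sub>F \<alpha> in at_left (1 / 2 :: real). 0 < \<alpha> \<and> \<alpha> < 1 / 2"
    by (auto simp: eventually_at_left_field intro!: exI[of _ 0])
  have kernel: "fourier_coeff (riesz_symbol (1 / 2)) = (\<lambda>n. - complex_of_real (1 / (pi * (of_int n + 1 / 2))))"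
    using riesz_kernel(2) by blast
  have kernel': "fourier_coeff (\<lambda>\<theta>. riesz_symbol (1 / 2) \<theta> * cis \<theta>)
      = (\<lambda>n. - complex_of_real (1 / (pi * (of_int n - 1 / 2))))"
    unfolding fourier_coeff_mult_cis_1 kernel by (simp add: fun_eq_iff)
  have "multiplier_limit (\<lambda>\<alpha> f. fwd_diff (frac_integral \<alpha> f)) (at_left (1 / 2)) R \<longleftrightarrow>
      (\<forall>f\<in>schwartz_Z. R f = conv_Z (fourier_coeff (riesz_symbol (1 / 2))) f)"
  proof (rule multiplier_limit_iff[OF s])
    show "\<forall>\<^sub>F \<alpha> in at_left (1 / 2). has_fourier_multiplier (\<lambda>f. fwd_diff (frac_integral \<alpha> f)) (riesz_symbol \<alpha>)"
      using near by eventually_elim (simp add: fwd_diff_frac_integral_multiplier)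
  qed (auto intro: riesz_symbol_tendsto riesz_kernel(1))
  moreover have "multiplier_limit (\<lambda>\<alpha> f. bwd_diff (frac_integral \<alpha> f)) (at_left (1 / 2)) R' \<longleftrightarrow>
      (\<forall>f\<in>schwartz_Z. R' f = conv_Z (fourier_coeff (\<lambda>\<theta>. riesz_symbol (1 / 2) \<theta> * cis \<theta>)) f)"
  proof (rule multiplier_limit_iff[OF s])
    show "\<forall>\<^sub>F \<alpha> in at_left (1 / 2). has_fourier_multiplier (\<lambda>f. bwd_diff (frac_integral \<alpha> f))
        (\<lambda>\<theta>. riesz_symbol \<alpha> \<theta> * cis \<theta>)"
      using near by eventually_elim (simp add: bwd_diff_frac_integral_multiplier)
  qed (auto intro!: tendsto_mult riesz_symbol_tendsto integrable_torus_mult_cis_1 riesz_kernel(1))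
  ultimately show ?thesis unfolding kernel kernel' by blast
qed

end
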